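(* Let $n$ and $r$ be integers with $1\leq r\leq \lfloor n/2\rfloor$. Let $\mathrm{Skew}_n$ be the space of real skew-symmetric $n\times n$ matrices with the Frobenius inner product $\langle A,B\rangle=\mathrm{Tr}(A^{\mathsf T}B)$. Then the smooth semialgebraic set $\mathrm{Skew}_{n,2r}=\{A\in \mathrm{Skew}_n : \mathrm{rank}(A)=2r\}$ is a minimal submanifold of the Euclidean space $(\mathrm{Skew}_n,\langle\cdot,\cdot\rangle)$.
   Context: A (smooth, embedded, not necessarily closed) submanifold $X$ of a Riemannian manifold $(M,g)$ is called minimal if its mean curvature vector field $H$ is identically zero. Here $H$ is the trace with respect to the induced metric of the second fundamental form $b(\xi,\eta)=(\nabla_\xi\vec\eta)^\perp$ of $X$, where $\nabla$ is the Levi-Civita connection of $M$, $\vec\eta$ is a local vector field extending $\eta$ that is tangent to $X$ along $X$, and $\perp$ denotes the component normal to $X$. In a local frame $e^1,\dots,e^k$ of $TX$ with Gram matrix $G=(g(e^i,e^j))$, $H=\sum_{i,j}(G^{-1})_{ij}\,b(e^i,e^j)$. *)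

theory Defs
  imports "HOL-Analysis.Analysis"
begin

section \<open>Smooth maps\<close>

text \<open>
  \<open>C_diff k S f\<close> is meaningful for open \<open>S\<close>: \<open>f\<close> is of class \<open>C^k\<close> on \<open>S\<close>
  (for a finite-dimensional domain, continuity of the derivative may be tested direction by
  direction).
\<close>

primrec C_diff :: "nat \<Rightarrow> 'a::euclidean_space set \<Rightarrow> ('a \<Rightarrow> 'b::euclidean_space) \<Rightarrow> bool" where
  "C_diff 0 S f \<longleftrightarrow> continuous_on S f"
| "C_diff (Suc k) S f \<longleftrightarrow>
     (\<forall>x\<in>S. f differentiable (at x)) \<and>
     (\<forall>v. C_diff k S (\<lambda>x. frechet_derivative f (at x) v))"

text \<open>
  On an arbitrary set, smoothness means that the map extends locally to a smooth map on an
  open set. On a relatively open subset of a linear subspace \<open>V\<close> this is smoothness as a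
  map on an open subset of the vector space \<open>V\<close>.
\<close>

definition smooth_map_on :: "'a::euclidean_space set \<Rightarrow> ('a \<Rightarrow> 'b::euclidean_space) \<Rightarrow> bool" where
  "smooth_map_on S f \<longleftrightarrow>
     (\<forall>x\<in>S. \<exists>N F. open N \<and> x \<in> N \<and> (\<forall>k. C_diff k N F) \<and> (\<forall>y\<in>S \<inter> N. F y = f y))"

definition diffeomorphism ::
    "'a::euclidean_space set \<Rightarrow> 'b::euclidean_space set \<Rightarrow> ('a \<Rightarrow> 'b) \<Rightarrow> ('b \<Rightarrow> 'a) \<Rightarrow> bool" where
  "diffeomorphism S T f g \<longleftrightarrow> homeomorphism S T f g \<and> smooth_map_on S f \<and> smooth_map_on T g"


section \<open>Submanifolds of a Euclidean space\<close>

text \<open>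
  The ambient Riemannian manifold is a linear subspace \<open>V\<close> of a type of class
  \<^class>\<open>euclidean_space\<close>, with the restriction of the inner product of that type. In the
  definition of an embedded submanifold, \<open>\<phi>\<close> is a slice chart of \<open>V\<close>, with model space a
  \<open>k\<close>-dimensional linear subspace \<open>L\<close> of \<open>V\<close>.
\<close>

definition embedded_submanifold :: "'a::euclidean_space set \<Rightarrow> nat \<Rightarrow> 'a set \<Rightarrow> bool" where
  "embedded_submanifold V k X \<longleftrightarrow>
     X \<subseteq> V \<and>
     (\<forall>p\<in>X. \<exists>U W L \<phi> \<psi>.
        openin (top_of_set V) U \<and> p \<in> U \<and> openin (top_of_set V) W \<and>
        diffeomorphism U W \<phi> \<psi> \<and>
        subspace L \<and> L \<subseteq> V \<and> dim L = k \<and>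
        \<phi> ` (X \<inter> U) = L \<inter> W)"

definition tangent_space :: "'a::euclidean_space set \<Rightarrow> 'a \<Rightarrow> 'a set" where
  "tangent_space X p =
     {v. \<exists>\<gamma> \<epsilon>. 0 < \<epsilon> \<and> smooth_map_on {-\<epsilon><..<\<epsilon>::real} \<gamma> \<and> \<gamma> ` {-\<epsilon><..<\<epsilon>} \<subseteq> X \<and>
             \<gamma> 0 = p \<and> (\<gamma> has_vector_derivative v) (at 0)}"

definition normal_space :: "'a::euclidean_space set \<Rightarrow> 'a set \<Rightarrow> 'a \<Rightarrow> 'a set" where
  "normal_space V X p = {\<nu> \<in> V. \<forall>\<tau>\<in>tangent_space X p. \<nu> \<bullet> \<tau> = 0}"

definition normal_component :: "'a::euclidean_space set \<Rightarrow> 'a set \<Rightarrow> 'a \<Rightarrow> 'a \<Rightarrow> 'a" where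
  "normal_component V X p w =
     (THE \<nu>. \<nu> \<in> normal_space V X p \<and> w - \<nu> \<in> tangent_space X p)"


section \<open>Second fundamental form and mean curvature\<close>

text \<open>
  The Levi-Civita connection of a Euclidean space is the directional derivative of vector
  fields. If \<open>Y\<close> is defined near \<open>p\<close> in \<open>V\<close> and \<open>\<xi> \<in> V\<close>, only values of \<open>Y\<close> on \<open>V\<close> matter.
\<close>

definition flat_connection ::
    "'a::euclidean_space \<Rightarrow> 'a \<Rightarrow> ('a \<Rightarrow> 'a) \<Rightarrow> 'a" where
  "flat_connection p \<xi> Y = vector_derivative (\<lambda>t. Y (p + t *\<^sub>R \<xi>)) (at 0)"

text \<open>\<open>Y\<close> is a local vector field of \<open>V\<close>, defined on \<open>U\<close>, that is tangent to \<open>X\<close> along \<open>X\<close>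
  and has the value \<open>\<eta>\<close> at \<open>p\<close>.\<close>

definition tangential_extension ::
    "'a::euclidean_space set \<Rightarrow> 'a set \<Rightarrow> 'a \<Rightarrow> 'a \<Rightarrow> 'a set \<Rightarrow> ('a \<Rightarrow> 'a) \<Rightarrow> bool" where
  "tangential_extension V X p \<eta> U Y \<longleftrightarrow>
     openin (top_of_set V) U \<and> p \<in> U \<and> smooth_map_on U Y \<and> Y ` U \<subseteq> V \<and>
     (\<forall>q\<in>X \<inter> U. Y q \<in> tangent_space X q) \<and> Y p = \<eta>"

text \<open>The definite description expresses that the value does not depend on the extension
  \<open>Y\<close>, which is the case for submanifolds \<open>X\<close> of \<open>V\<close>.\<close>

definition second_fundamental_form ::
    "'a::euclidean_space set \<Rightarrow> 'a set \<Rightarrow> 'a \<Rightarrow> 'a \<Rightarrow> 'a \<Rightarrow> 'a" where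
  "second_fundamental_form V X p \<xi> \<eta> =
     (THE b. \<exists>U Y. tangential_extension V X p \<eta> U Y \<and>
                   b = normal_component V X p (flat_connection p \<xi> Y))"

text \<open>The trace of a bilinear map on a linear subspace \<open>T\<close> with respect to the inner product.
  The choice of the orthonormal basis is immaterial by \<open>metric_trace_frame\<close> below.\<close>

definition orthonormal_basis :: "'a::euclidean_space set \<Rightarrow> 'a set \<Rightarrow> bool" where
  "orthonormal_basis T B \<longleftrightarrow>
     B \<subseteq> T \<and> pairwise orthogonal B \<and> (\<forall>e\<in>B. norm e = 1) \<and> span B = T"

definition metric_trace ::
    "'a::euclidean_space set \<Rightarrow> ('a \<Rightarrow> 'a \<Rightarrow> 'b::real_vector) \<Rightarrow> 'b" where
  "metric_trace T \<beta> = (\<Sum>e\<in>(SOME B. orthonormal_basis T B). \<beta> e e)"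

definition mean_curvature :: "'a::euclidean_space set \<Rightarrow> 'a set \<Rightarrow> 'a \<Rightarrow> 'a" where
  "mean_curvature V X p = metric_trace (tangent_space X p) (second_fundamental_form V X p)"

definition minimal_submanifold :: "'a::euclidean_space set \<Rightarrow> 'a set \<Rightarrow> bool" where
  "minimal_submanifold V X \<longleftrightarrow>
     (\<exists>k. embedded_submanifold V k X) \<and> (\<forall>p\<in>X. mean_curvature V X p = 0)"

lemma orthonormal_basis_exists:
  assumes "subspace T"
  shows "\<exists>B. orthonormal_basis T B"
  using orthonormal_basis_subspace[OF assms] unfolding orthonormal_basis_def by metis

lemma orthonormal_basis_expand:
  fixes T :: "'a::euclidean_space set"
  assumes B: "orthonormal_basis T B" and x: "x \<in> T"
  shows "finite B" and "x = (\<Sum>b\<in>B. (x \<bullet> b) *\<^sub>R b)"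
proof -
  have po: "pairwise orthogonal B" and n1: "\<And>e. e \<in> B \<Longrightarrow> norm e = 1" and sp: "span B = T"
    using B by (auto simp: orthonormal_basis_def)
  have "0 \<notin> B" using n1[of 0] by auto
  then have "independent B" using po pairwise_orthogonal_independent by blast
  then show fin: "finite B" by (rule independent_imp_finite)
  have "x \<in> span B" using sp x by simp
  then obtain a where a: "x = (\<Sum>b\<in>B. a b *\<^sub>R b)" using span_finite[OF fin] by auto
  have "x \<bullet> c = a c" if c: "c \<in> B" for c
  proof -
    have "b \<bullet> c = (if b = c then 1 else 0)" if "b \<in> B" for b
      using po n1 c that by (auto simp: pairwise_def orthogonal_def dot_square_norm)
    then have "x \<bullet> c = (\<Sum>b\<in>B. if b = c then a b else 0)"
      unfolding a inner_sum_left by (intro sum.cong) auto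
    then show ?thesis using fin c by simp
  qed
  then show "x = (\<Sum>b\<in>B. (x \<bullet> b) *\<^sub>R b)" using a by simp
qed

text \<open>The trace in an arbitrary frame \<open>e\<close> with inverse Gram matrix \<open>Ginv\<close>.\<close>

lemma metric_trace_frame:
  fixes T :: "'a::euclidean_space set" and \<beta> :: "'a \<Rightarrow> 'a \<Rightarrow> 'b::real_vector"
    and e :: "'i \<Rightarrow> 'a" and Ginv :: "'i \<Rightarrow> 'i \<Rightarrow> real"
  assumes T: "subspace T"
    and addl: "\<And>x y z. x \<in> T \<Longrightarrow> y \<in> T \<Longrightarrow> z \<in> T \<Longrightarrow> \<beta> (x + y) z = \<beta> x z + \<beta> y z"
    and addr: "\<And>x y z. x \<in> T \<Longrightarrow> y \<in> T \<Longrightarrow> z \<in> T \<Longrightarrow> \<beta> z (x + y) = \<beta> z x + \<beta> z y"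
    and scl: "\<And>c x z. x \<in> T \<Longrightarrow> z \<in> T \<Longrightarrow> \<beta> (c *\<^sub>R x) z = c *\<^sub>R \<beta> x z"
    and scr: "\<And>c x z. x \<in> T \<Longrightarrow> z \<in> T \<Longrightarrow> \<beta> z (c *\<^sub>R x) = c *\<^sub>R \<beta> z x"
    and fin: "finite I" and e: "span (e ` I) = T"
    and Ginv: "\<And>i j. i \<in> I \<Longrightarrow> j \<in> I \<Longrightarrow>
                (\<Sum>l\<in>I. Ginv i l * (e l \<bullet> e j)) = (if i = j then 1 else 0)"
  shows "metric_trace T \<beta> = (\<Sum>i\<in>I. \<Sum>j\<in>I. Ginv i j *\<^sub>R \<beta> (e i) (e j))"
proof -
  define B where "B = (SOME B. orthonormal_basis T B)"
  have B: "orthonormal_basis T B"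
    unfolding B_def using orthonormal_basis_exists[OF T] by (rule someI_ex)
  have finB: "finite B" by (rule orthonormal_basis_expand(1)[OF B subspace_0[OF T]])
  have BT: "b \<in> T" if "b \<in> B" for b using B that by (auto simp: orthonormal_basis_def)
  have eT: "e i \<in> T" if "i \<in> I" for i using span_base[of "e i" "e ` I"] that unfolding e by simp
  have z: "\<beta> 0 w = 0" "\<beta> w 0 = 0" if "w \<in> T" for w
    using scl[of w w 0] scr[of w w 0] that by auto
  have suml: "\<beta> (\<Sum>a\<in>A. c a *\<^sub>R f a) w = (\<Sum>a\<in>A. c a *\<^sub>R \<beta> (f a) w)"
    if "finite A" "\<And>a. a \<in> A \<Longrightarrow> f a \<in> T" "w \<in> T" for A :: "'i set" and c f w
    using that by (induction A rule: finite_induct)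
      (auto simp: z addl scl subspace_scale[OF T] subspace_sum[OF T])
  have sumr: "\<beta> w (\<Sum>a\<in>A. c a *\<^sub>R f a) = (\<Sum>a\<in>A. c a *\<^sub>R \<beta> w (f a))"
    if "finite A" "\<And>a. a \<in> A \<Longrightarrow> f a \<in> T" "w \<in> T" for A :: "'a set" and c f w
    using that by (induction A rule: finite_induct)
      (auto simp: z addr scr subspace_scale[OF T] subspace_sum[OF T])
  have dual: "(\<Sum>i\<in>I. (\<Sum>j\<in>I. Ginv i j * (e j \<bullet> c)) *\<^sub>R e i) = c" if c: "c \<in> T" for c
  proof -
    have "\<exists>a. x = (\<Sum>i\<in>I. a i *\<^sub>R e i)" if "x \<in> span (e ` I)" for x
      using that
    proof (induction rule: span_induct_alt)
      case base
      show ?case by (rule exI[of _ "\<lambda>_. 0"]) simp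
    next
      case (step r x y)
      then obtain a k where a: "y = (\<Sum>i\<in>I. a i *\<^sub>R e i)" and k: "k \<in> I" "x = e k" by blast
      have "(\<Sum>i\<in>I. (if i = k then r else 0) *\<^sub>R e i) = (\<Sum>i\<in>I. if i = k then r *\<^sub>R e i else 0)"
        by (intro sum.cong) auto
      then have "r *\<^sub>R x + y = (\<Sum>i\<in>I. ((if i = k then r else 0) + a i) *\<^sub>R e i)"
        unfolding a scaleR_add_left sum.distrib using k fin by simp
      then show ?case by (rule exI[of _ "\<lambda>i. (if i = k then r else 0) + a i"])
    qed
    then obtain a where a: "c = (\<Sum>i\<in>I. a i *\<^sub>R e i)" using c e by blast
    have "(\<Sum>j\<in>I. Ginv i j * (e j \<bullet> c)) = a i" if i: "i \<in> I" for i
    proof -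
      have "(\<Sum>j\<in>I. Ginv i j * (e j \<bullet> c)) = (\<Sum>j\<in>I. \<Sum>l\<in>I. a l * (Ginv i j * (e j \<bullet> e l)))"
        unfolding a by (simp add: inner_sum_right sum_distrib_left mult.left_commute)
      also have "\<dots> = (\<Sum>l\<in>I. a l * (\<Sum>j\<in>I. Ginv i j * (e j \<bullet> e l)))"
        by (subst sum.swap) (simp add: sum_distrib_left)
      also have "\<dots> = (\<Sum>l\<in>I. if i = l then a l else 0)"
        using Ginv i by (intro sum.cong) auto
      finally show ?thesis using fin i by simp
    qed
    then show ?thesis using a by simp
  qed
  have "(\<Sum>i\<in>I. \<Sum>j\<in>I. Ginv i j *\<^sub>R \<beta> (e i) (e j))
      = (\<Sum>i\<in>I. \<Sum>j\<in>I. \<Sum>c\<in>B. (Ginv i j * (e j \<bullet> c)) *\<^sub>R \<beta> (e i) c)"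
  proof (intro sum.cong refl)
    fix i j assume ij: "i \<in> I" "j \<in> I"
    have "\<beta> (e i) (e j) = \<beta> (e i) (\<Sum>c\<in>B. (e j \<bullet> c) *\<^sub>R c)"
      using orthonormal_basis_expand(2)[OF B eT[OF ij(2)]] by simp
    also have "\<dots> = (\<Sum>c\<in>B. (e j \<bullet> c) *\<^sub>R \<beta> (e i) c)"
      using sumr[of B "\<lambda>c. c" "e i" "\<lambda>c. e j \<bullet> c"] finB BT eT ij by simp
    finally show "Ginv i j *\<^sub>R \<beta> (e i) (e j) = (\<Sum>c\<in>B. (Ginv i j * (e j \<bullet> c)) *\<^sub>R \<beta> (e i) c)"
      by (simp add: scaleR_sum_right)
  qed
  also have "\<dots> = (\<Sum>i\<in>I. \<Sum>c\<in>B. \<Sum>j\<in>I. (Ginv i j * (e j \<bullet> c)) *\<^sub>R \<beta> (e i) c)"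
    by (intro sum.cong refl sum.swap)
  also have "\<dots> = (\<Sum>c\<in>B. \<Sum>i\<in>I. (\<Sum>j\<in>I. Ginv i j * (e j \<bullet> c)) *\<^sub>R \<beta> (e i) c)"
    by (subst sum.swap) (simp add: scaleR_left.sum)
  also have "\<dots> = (\<Sum>c\<in>B. \<beta> c c)"
  proof (intro sum.cong refl)
    fix c assume c: "c \<in> B"
    have "(\<Sum>i\<in>I. (\<Sum>j\<in>I. Ginv i j * (e j \<bullet> c)) *\<^sub>R \<beta> (e i) c)
        = \<beta> (\<Sum>i\<in>I. (\<Sum>j\<in>I. Ginv i j * (e j \<bullet> c)) *\<^sub>R e i) c"
      using suml[of I e c "\<lambda>i. \<Sum>j\<in>I. Ginv i j * (e j \<bullet> c)"] fin eT BT c by simp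
    then show "(\<Sum>i\<in>I. (\<Sum>j\<in>I. Ginv i j * (e j \<bullet> c)) *\<^sub>R \<beta> (e i) c) = \<beta> c c"
      using dual[OF BT[OF c]] by simp
  qed
  finally show ?thesis by (simp add: metric_trace_def B_def)
qed


section \<open>Semialgebraic sets\<close>

text \<open>Polynomial functions on a linear subspace are the restrictions of polynomial functions
  on the whole space, and the subspace is itself semialgebraic. Hence a subset of a subspace
  is semialgebraic in the subspace iff it is so in the whole space.\<close>

inductive semialgebraic :: "'a::euclidean_space set \<Rightarrow> bool" where
  zero: "real_polynomial_function f \<Longrightarrow> semialgebraic {x. f x = 0}"
| pos: "real_polynomial_function f \<Longrightarrow> semialgebraic {x. f x > 0}"
| Un: "semialgebraic S \<Longrightarrow> semialgebraic T \<Longrightarrow> semialgebraic (S \<union> T)"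
| Int: "semialgebraic S \<Longrightarrow> semialgebraic T \<Longrightarrow> semialgebraic (S \<inter> T)"
| Compl: "semialgebraic S \<Longrightarrow> semialgebraic (- S)"


section \<open>Skew-symmetric matrices\<close>

definition Skew :: "(real^'n^'n) set" where
  "Skew = {A. transpose A = - A}"

definition Skew_rank :: "nat \<Rightarrow> (real^'n^'n) set" where
  "Skew_rank k = {A \<in> Skew. rank A = k}"

lemma subspace_Skew: "subspace (Skew :: (real^'n^'n) set)"
proof (rule subspaceI)
  show "(0 :: real^'n^'n) \<in> Skew"
    by (simp add: Skew_def transpose_def vec_eq_iff)
next
  fix A B :: "real^'n^'n"
  assume "A \<in> Skew" "B \<in> Skew"
  moreover have "transpose (A + B) = transpose A + transpose B"
    by (simp add: transpose_def vec_eq_iff)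
  ultimately show "A + B \<in> Skew"
    by (simp add: Skew_def)
next
  fix c and A :: "real^'n^'n"
  assume "A \<in> Skew"
  moreover have "transpose (c *\<^sub>R A) = c *\<^sub>R transpose A"
    by (simp add: transpose_def vec_eq_iff)
  ultimately show "c *\<^sub>R A \<in> Skew"
    by (simp add: Skew_def)
qed

text \<open>The inner product of the type of matrices is the Frobenius inner product.\<close>

lemma inner_eq_Frobenius:
  fixes A B :: "real^'n^'n"
  shows "A \<bullet> B = trace (transpose A ** B)"
  unfolding inner_vec_def trace_def matrix_matrix_mult_def transpose_def
  by (simp, rule sum.swap)

end

theory Submission
  imports Defs
begin

text \<open>
  Let \<open>p\<close> be skew-symmetric of rank \<open>k\<close>, let \<open>Q\<close> be the orthogonal projection onto the kernel of
  \<open>p\<close>, \<open>P = 1 - Q\<close>, and let \<open>R\<close> be the pseudoinverse of \<open>p\<close>, so that \<open>p R = R p = P\<close> and \<open>R\<close> is again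
  skew-symmetric with \<open>R Q = Q R = 0\<close>.

  Near \<open>p\<close> the block \<open>P A P\<close> stays invertible, and \<open>A\<close> has rank \<open>k\<close> exactly if its Schur complement
  vanishes, that is, if \<open>Q A Q\<close> equals a smooth function of the other blocks (\<open>rank_eq_iff_schur\<close>).
  So the stratum of rank \<open>k\<close> is locally a graph over the space of skew-symmetric \<open>B\<close> with
  \<open>Q B Q = 0\<close>, which gives slice charts (\<open>schur_chart\<close>). The dimension of this space is the trace of
  its orthogonal projection and depends only on \<open>k\<close> (\<open>dim_tangent_model\<close>).

  The same space is the tangent space at \<open>p\<close>, and it consists of the velocities \<open>C p + p C\<^sup>T\<close> of
  congruences (\<open>tangent_space_eq_model\<close>, \<open>tangent_model_velocity\<close>). Hence every tangent vector
  extends to the linear vector field \<open>A \<mapsto> C A + A C\<^sup>T\<close>, which is tangent to the stratum everywhere.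
  Transporting an arbitrary tangential extension back to \<open>p\<close> by congruence and differentiating
  shows that the normal part of its derivative in direction \<open>\<xi>\<close> depends only on \<open>\<xi>\<close> and the value
  \<open>\<eta>\<close> at \<open>p\<close>, and yields
  \<open>b(\<xi>, \<eta>) = Q (\<xi> R \<eta> + \<eta> R \<xi>) Q\<close> (\<open>second_fundamental_form_Skew_rank\<close>).

  For the mean curvature, the trace of \<open>(x, y) \<mapsto> x R y\<close> over the tangent space is rewritten as a
  sum over matrix units in which the first argument is projected to the tangent space
  (\<open>sum_orthonormal_basis\<close>). Since \<open>R Q = Q R = 0\<close>, the projection may be replaced by the skew
  part. The sum is then \<open>- R / 2\<close>, because \<open>R\<close> is skew-symmetric
  and has trace zero (\<open>sum_matrix_units_R\<close>), and \<open>Q R Q = 0\<close>.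

  Semialgebraicity follows since \<open>k \<le> rank A\<close> says that some \<open>k\<close> rows of \<open>A\<close> have a nonzero Gram
  determinant (\<open>le_rank_iff_padded_gram\<close>).
\<close>

section \<open>Matrix multiplication and inversion as smooth operations\<close>

lemma bounded_bilinear_matrix_mult:
  "bounded_bilinear ((**) :: real^'n^'m \<Rightarrow> real^'p^'n \<Rightarrow> real^'p^'m)"
proof -
  have "bilinear ((**) :: real^'n^'m \<Rightarrow> real^'p^'n \<Rightarrow> real^'p^'m)"
    unfolding bilinear_def
    by (auto intro!: linearI simp: matrix_add_ldistrib vec_eq_iff matrix_matrix_mult_def
        algebra_simps sum.distrib sum_distrib_left)
  then show ?thesis
    by (simp add: bilinear_conv_bounded_bilinear)
qed

interpretation matmul: bounded_bilinear "(**) :: real^'n^'m \<Rightarrow> real^'p^'n \<Rightarrow> real^'p^'m"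
  by (rule bounded_bilinear_matrix_mult)

lemma transpose_add: "transpose (A + B) = transpose A + transpose B"
  and transpose_diff: "transpose (A - B) = transpose A - transpose B"
  and transpose_minus: "transpose (- A) = - transpose A"
  for A B :: "'a::ab_group_add^'n^'m"
  by (simp_all add: transpose_def vec_eq_iff)

lemma bounded_linear_transpose: "bounded_linear (transpose :: real^'n^'m \<Rightarrow> real^'m^'n)"
  by (auto intro!: linearI simp: linear_conv_bounded_linear[symmetric] transpose_add transpose_scalar)

lemma matrix_inv_works:
  fixes A :: "real^'n^'n"
  assumes "invertible A"
  shows "A ** matrix_inv A = mat 1" "matrix_inv A ** A = mat 1"
  using someI_ex[of "\<lambda>B. A ** B = mat 1 \<and> B ** A = mat 1"] assms
  unfolding invertible_def matrix_inv_def by blast+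

lemma matrix_inv_unique:
  fixes A B :: "real^'n^'n"
  assumes "A ** B = mat 1"
  shows "matrix_inv A = B"
proof -
  have "invertible A"
    using assms matrix_left_right_inverse unfolding invertible_def by blast
  then have "matrix_inv A ** A = mat 1" by (rule matrix_inv_works)
  then show ?thesis
    using assms by (metis matrix_mul_assoc matrix_mul_lid matrix_mul_rid)
qed

lemma invertible_transpose_iff: "invertible (transpose A) \<longleftrightarrow> invertible A" for A :: "real^'n^'n"
  using transpose_invertible[of A] transpose_invertible[of "transpose A"] by auto

lemma tendsto_det:
  fixes f :: "'a \<Rightarrow> real^'n^'n"
  assumes "(f \<longlongrightarrow> A) F"
  shows "((\<lambda>x. det (f x)) \<longlongrightarrow> det A) F"
  unfolding det_def by (intro tendsto_intros assms)

lemma open_invertible: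
  fixes f :: "'a::topological_space \<Rightarrow> real^'n^'n"
  assumes "continuous_on UNIV f"
  shows "open {x. invertible (f x)}"
proof -
  have "continuous_on UNIV (\<lambda>x. det (f x))"
    using assms unfolding continuous_on_def by (blast intro: tendsto_det)
  then have "open {x. det (f x) \<noteq> 0}"
    by (intro open_Collect_neq continuous_on_const)
  then show ?thesis
    by (simp add: invertible_det_nz)
qed

lemma eventually_invertible:
  fixes f :: "'a \<Rightarrow> real^'n^'n"
  assumes "(f \<longlongrightarrow> A) F" "invertible A"
  shows "eventually (\<lambda>x. invertible (f x)) F"
  using tendsto_imp_eventually_ne[OF tendsto_det[OF assms(1)]] assms(2)
  by (simp add: invertible_det_nz)

text \<open>Cramer's rule exhibits the entries of the inverse as quotients of determinants.\<close>

lemma tendsto_matrix_inv: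
  fixes f :: "'a \<Rightarrow> real^'n^'n"
  assumes f: "(f \<longlongrightarrow> A) F" and A: "invertible A"
  shows "((\<lambda>x. matrix_inv (f x)) \<longlongrightarrow> matrix_inv A) F"
proof -
  define m :: "'n \<Rightarrow> 'n \<Rightarrow> real^'n^'n \<Rightarrow> real^'n^'n"
    where "m k j B = (\<chi> i l. if l = k then axis j 1 $ i else B $ i $ l)" for k j B
  have entry: "matrix_inv B $ k $ j = det (m k j B) / det B" if B: "invertible B" for B k j
  proof -
    have "B *v (matrix_inv B *v axis j 1) = axis j 1"
      by (simp add: matrix_vector_mul_assoc matrix_inv_works B)
    then have "matrix_inv B *v axis j 1 = (\<chi> k. det (m k j B) / det B)"
      unfolding m_def using B cramer[of B "matrix_inv B *v axis j 1" "axis j 1"]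
      by (simp add: invertible_det_nz)
    moreover have "(matrix_inv B *v axis j 1) $ k = matrix_inv B $ k $ j"
      by (simp add: matrix_vector_mult_basis column_def)
    ultimately show ?thesis by simp
  qed
  have m: "((\<lambda>x. m k j (f x)) \<longlongrightarrow> m k j A) F" for k j
    unfolding m_def
  proof (intro vec_tendstoI)
    fix i l
    show "((\<lambda>x. (\<chi> i l. if l = k then axis j 1 $ i else f x $ i $ l) $ i $ l) \<longlongrightarrow>
            (\<chi> i l. if l = k then axis j 1 $ i else A $ i $ l) $ i $ l) F"
      by (cases "l = k") (auto intro!: tendsto_intros f)
  qed
  have det_nz: "det A \<noteq> 0" using A by (simp add: invertible_det_nz)
  show ?thesis
  proof (intro vec_tendstoI)
    fix k j
    have "((\<lambda>x. det (m k j (f x)) / det (f x)) \<longlongrightarrow> det (m k j A) / det A) F"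
      by (intro tendsto_divide tendsto_det m f det_nz)
    moreover have "eventually (\<lambda>x. det (m k j (f x)) / det (f x) = matrix_inv (f x) $ k $ j) F"
      using eventually_invertible[OF f A] by eventually_elim (simp add: entry)
    ultimately show "((\<lambda>x. matrix_inv (f x) $ k $ j) \<longlongrightarrow> matrix_inv A $ k $ j) F"
      by (simp add: entry A Lim_transform_eventually)
  qed
qed

text \<open>
  The derivative is read off from the exact difference formula
  \<open>B\<inverse> - A\<inverse> = - B\<inverse> (B - A) A\<inverse>\<close>. Replacing the factor \<open>B\<inverse>\<close> by \<open>A\<inverse>\<close> costs a product of a
  function tending to zero and a Lipschitz function.
\<close>

lemma has_derivative_matrix_inv:
  fixes f :: "'a::euclidean_space \<Rightarrow> real^'n^'n"
  assumes f: "(f has_derivative f') (at x)" and inv: "invertible (f x)"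
  shows "((\<lambda>y. matrix_inv (f y)) has_derivative
           (\<lambda>h. - (matrix_inv (f x) ** f' h ** matrix_inv (f x)))) (at x)"
proof -
  define a where "a = matrix_inv (f x)"
  define u where "u y = matrix_inv (f y) - a" for y
  define v where "v y = (f y - f x) ** a" for y
  have fc: "(f \<longlongrightarrow> f x) (at x)"
    using has_derivative_continuous[OF f] by (simp add: continuous_at)
  have u: "(u \<longlongrightarrow> 0) (at x)"
    unfolding u_def a_def using tendsto_diff[OF tendsto_matrix_inv[OF fc inv] tendsto_const[of "matrix_inv (f x)"]] by simp
  have v: "(v has_derivative (\<lambda>h. f' h ** a)) (at x)"
    unfolding v_def
    using bounded_linear.has_derivative[OF matmul.bounded_linear_left
        has_derivative_diff[OF f has_derivative_const]] by simp
  have bl: "bounded_linear f'" using f by (rule has_derivative_bounded_linear)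
  obtain K where K: "norm (f' h) \<le> norm h * K" for h
    using bounded_linear.bounded[OF bl] by blast
  have uv: "((\<lambda>y. u y ** v y) has_derivative (\<lambda>h. 0)) (at x)"
    unfolding has_derivative_at
  proof (intro conjI bounded_linear_zero)
    define e where "e h = norm (v (x + h) - v x - f' h ** a) / norm h" for h
    have e: "(e \<longlongrightarrow> 0) (at 0)"
      using v unfolding has_derivative_at e_def by blast
    have u0: "((\<lambda>h. u (x + h)) \<longlongrightarrow> 0) (at 0)"
      using u by (simp add: LIM_offset_zero)
    obtain C where C: "\<And>B D. norm ((B::real^'n^'n) ** (D::real^'n^'n)) \<le> norm B * norm D * C"
      and C0: "0 \<le> C"
      using matmul.nonneg_bounded by blast
    have lim: "((\<lambda>h. norm (u (x + h)) * (e h + K * norm a * C) * C) \<longlongrightarrow> 0) (at 0)"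
    proof -
      have "((\<lambda>h. norm (u (x + h)) * (e h + K * norm a * C) * C) \<longlongrightarrow>
              norm (0 :: real^'n^'n) * (0 + K * norm a * C) * C) (at 0)"
        by (intro tendsto_mult tendsto_norm tendsto_add tendsto_const u0 e)
      then show ?thesis by simp
    qed
    show "((\<lambda>h. norm (u (x + h) ** v (x + h) - u x ** v x - 0) / norm h) \<longlongrightarrow> 0) (at 0)"
    proof (rule Lim_null_comparison[OF _ lim])
      show "eventually (\<lambda>h. norm (norm (u (x + h) ** v (x + h) - u x ** v x - 0) / norm h)
              \<le> norm (u (x + h)) * (e h + K * norm a * C) * C) (at 0)"
      proof (rule eventually_at_topological[THEN iffD2], intro exI[of _ UNIV] conjI ballI impI)
        fix h :: 'a assume h: "h \<noteq> 0"
        have "norm (v (x + h)) \<le> norm (v (x + h) - v x - f' h ** a) + norm (f' h ** a)"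
          using norm_triangle_ineq[of "v (x + h) - f' h ** a" "f' h ** a"] by (simp add: v_def)
        also have "\<dots> \<le> norm (v (x + h) - v x - f' h ** a) + norm h * K * norm a * C"
          using C[of "f' h" a] mult_right_mono[OF mult_right_mono[OF K, of "norm a"], of C h] C0
          by simp
        also have "\<dots> = norm h * (e h + K * norm a * C)"
          using h by (simp add: e_def algebra_simps)
        finally have vb: "norm (v (x + h)) \<le> norm h * (e h + K * norm a * C)" .
        have "norm (u (x + h) ** v (x + h)) \<le> norm (u (x + h)) * norm (v (x + h)) * C"
          by (rule C)
        also have "\<dots> \<le> norm (u (x + h)) * (norm h * (e h + K * norm a * C)) * C"
          by (intro mult_right_mono mult_left_mono vb C0 norm_ge_zero)
        finally have "norm (u (x + h) ** v (x + h)) / norm h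
            \<le> norm (u (x + h)) * (norm h * (e h + K * norm a * C)) * C / norm h"
          by (rule divide_right_mono) simp
        also have "\<dots> = norm (u (x + h)) * (e h + K * norm a * C) * C"
          using h by simp
        finally show "norm (norm (u (x + h) ** v (x + h) - u x ** v x - 0) / norm h)
              \<le> norm (u (x + h)) * (e h + K * norm a * C) * C"
          by (simp add: v_def)
      qed simp_all
    qed
  qed
  have "((\<lambda>y. a - (a ** v y) - u y ** v y) has_derivative (\<lambda>h. - (a ** f' h ** a))) (at x)"
    using has_derivative_diff[OF has_derivative_diff[OF has_derivative_const
          bounded_linear.has_derivative[OF matmul.bounded_linear_right v]] uv]
    by (simp add: matrix_mul_assoc)
  then show ?thesis
    unfolding a_def[symmetric]
  proof (rule has_derivative_transform_eventually)
    show "eventually (\<lambda>y. a - (a ** v y) - u y ** v y = matrix_inv (f y)) (at x)"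
      using eventually_invertible[OF fc inv]
    proof eventually_elim
      case (elim y)
      have "matrix_inv (f y) ** v y = (matrix_inv (f y) ** f y) ** a - matrix_inv (f y) ** (f x ** a)"
        by (simp add: v_def matmul.diff_left matmul.diff_right matrix_mul_assoc)
      also have "\<dots> = a - matrix_inv (f y)"
        by (simp add: a_def matrix_inv_works elim inv)
      finally show ?case
        by (simp add: u_def matmul.diff_left)
    qed
    show "a - (a ** v x) - u x ** v x = matrix_inv (f x)"
      by (simp add: v_def a_def)
  qed simp
qed

section \<open>A calculus of smooth maps\<close>

text \<open>
  The class \<open>C_diff\<close> is defined through the chosen derivative, so each closure property below is
  an induction on the order in which the derivative is first identified on the open set.
\<close>

lemma C_diff_cong:
  fixes f g :: "'a::euclidean_space \<Rightarrow> 'b::euclidean_space"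
  assumes "open S" "\<And>x. x \<in> S \<Longrightarrow> f x = g x"
  shows "C_diff k S f \<longleftrightarrow> C_diff k S g"
  using assms(2)
proof (induction k arbitrary: f g)
  case 0
  then show ?case by (simp cong: continuous_on_cong)
next
  case (Suc k)
  have imp: "C_diff (Suc k) S g" if C: "C_diff (Suc k) S f" and eq: "\<And>x. x \<in> S \<Longrightarrow> f x = g x"
    for f g :: "'a \<Rightarrow> 'b"
  proof -
    have d: "f differentiable at x" if "x \<in> S" for x using C that by simp
    have "g differentiable at x" if "x \<in> S" for x
      using d[OF that] eq that assms(1) unfolding differentiable_def
      by (metis has_derivative_transform_within_open)
    moreover have "frechet_derivative f (at x) = frechet_derivative g (at x)" if "x \<in> S" for x
      by (rule frechet_derivative_transform_within_open[OF d[OF that] assms(1) that eq])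
    then have "C_diff k S (\<lambda>x. frechet_derivative g (at x) v)" for v
      using C Suc.IH[of "\<lambda>x. frechet_derivative f (at x) v" "\<lambda>x. frechet_derivative g (at x) v"] by simp
    ultimately show ?thesis by simp
  qed
  show ?case
    using imp[OF _ Suc.prems] imp[OF _ Suc.prems[symmetric]] by (rule iffI)
qed

lemma C_diff_SucI:
  assumes "open S" and f: "\<And>x. x \<in> S \<Longrightarrow> (f has_derivative f' x) (at x)"
    and f': "\<And>v. C_diff k S (\<lambda>x. f' x v)"
  shows "C_diff (Suc k) S f"
proof -
  have "C_diff k S (\<lambda>x. frechet_derivative f (at x) v)" for v
    using C_diff_cong[OF assms(1), of "\<lambda>x. f' x v" "\<lambda>x. frechet_derivative f (at x) v" k]
      f' frechet_derivative_at[OF f] by metis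
  moreover have "f differentiable at x" if "x \<in> S" for x
    using f[OF that] by (rule differentiableI)
  ultimately show ?thesis by simp
qed

lemma C_diff_has_derivative:
  assumes "C_diff (Suc k) S f" "x \<in> S"
  shows "(f has_derivative frechet_derivative f (at x)) (at x)"
  using assms frechet_derivative_works by auto

lemma C_diff_Suc_D: "C_diff (Suc k) S f \<Longrightarrow> C_diff k S f"
proof (induction k arbitrary: f)
  case 0
  then show ?case
    by (simp add: continuous_at_imp_continuous_on differentiable_imp_continuous_within)
next
  case (Suc k)
  have d: "\<forall>x\<in>S. f differentiable (at x)"
    and C: "\<forall>v. C_diff (Suc k) S (\<lambda>x. frechet_derivative f (at x) v)"
    using iffD1[OF C_diff.simps(2) Suc.prems] by (rule conjunct1, rule conjunct2)
  show ?case
    unfolding C_diff.simps(2)[of k S f]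
    by (intro conjI d allI Suc.IH C[rule_format])
qed

lemma C_diff_const: "C_diff k S (\<lambda>x. c)"
  by (induction k arbitrary: c) auto

lemma C_diff_bounded_linear:
  assumes "bounded_linear f"
  shows "C_diff k S f"
proof (cases k)
  case 0
  then show ?thesis using assms by (simp add: linear_continuous_on)
next
  case (Suc k)
  have "frechet_derivative f (at x) = f" for x
    using frechet_derivative_at[OF bounded_linear.has_derivative[OF assms has_derivative_ident]] by simp
  moreover have "f differentiable at x" for x
    by (rule bounded_linear_imp_differentiable[OF assms])
  ultimately show ?thesis
    using Suc by (simp add: C_diff_const)
qed

lemma C_diff_add:
  assumes "open S"
  shows "C_diff k S f \<Longrightarrow> C_diff k S g \<Longrightarrow> C_diff k S (\<lambda>x. f x + g x)"
proof (induction k arbitrary: f g)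
  case 0
  then show ?case by (simp add: continuous_on_add)
next
  case (Suc k)
  show ?case
  proof (rule C_diff_SucI[OF assms])
    show "((\<lambda>x. f x + g x) has_derivative
        (\<lambda>v. frechet_derivative f (at x) v + frechet_derivative g (at x) v)) (at x)" if "x \<in> S" for x
      using Suc.prems that by (intro has_derivative_add C_diff_has_derivative)
    show "C_diff k S (\<lambda>x. frechet_derivative f (at x) v + frechet_derivative g (at x) v)" for v
      using Suc.prems by (intro Suc.IH) auto
  qed
qed

lemma C_diff_bilinear:
  assumes "open S" and bb: "bounded_bilinear b"
  shows "C_diff k S f \<Longrightarrow> C_diff k S g \<Longrightarrow> C_diff k S (\<lambda>x. b (f x) (g x))"
proof (induction k arbitrary: f g)
  case 0
  then show ?case by (simp add: bounded_bilinear.continuous_on[OF bb])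
next
  case (Suc k)
  show ?case
  proof (rule C_diff_SucI[OF assms(1)])
    show "((\<lambda>x. b (f x) (g x)) has_derivative
        (\<lambda>v. b (f x) (frechet_derivative g (at x) v) + b (frechet_derivative f (at x) v) (g x))) (at x)"
      if "x \<in> S" for x
      using Suc.prems that by (intro bounded_bilinear.FDERIV[OF bb] C_diff_has_derivative)
    show "C_diff k S (\<lambda>x. b (f x) (frechet_derivative g (at x) v) + b (frechet_derivative f (at x) v) (g x))" for v
    proof -
      have "C_diff k S f" "C_diff k S g"
        using Suc.prems by (auto intro: C_diff_Suc_D simp del: C_diff.simps)
      moreover have "C_diff k S (\<lambda>x. frechet_derivative f (at x) v)"
        "C_diff k S (\<lambda>x. frechet_derivative g (at x) v)"
        using Suc.prems by simp_all
      ultimately show ?thesis by (intro C_diff_add Suc.IH assms(1))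
    qed
  qed
qed

lemmas C_diff_matrix_mult = C_diff_bilinear[OF _ bounded_bilinear_matrix_mult]

lemma C_diff_minus:
  assumes "open S" "C_diff k S f"
  shows "C_diff k S (\<lambda>x. - f x)"
  using C_diff_bilinear[OF assms(1) bounded_bilinear_scaleR C_diff_const[of k S "-1"] assms(2)] by simp

lemma C_diff_matrix_inv:
  fixes f :: "'a::euclidean_space \<Rightarrow> real^'n^'n"
  assumes "open S" and inv: "\<And>x. x \<in> S \<Longrightarrow> invertible (f x)"
  shows "C_diff k S f \<Longrightarrow> C_diff k S (\<lambda>x. matrix_inv (f x))"
proof (induction k)
  case 0
  then show ?case
    using inv by (auto simp: continuous_on_def intro: tendsto_matrix_inv)
next
  case (Suc k)
  show ?case
  proof (rule C_diff_SucI[OF assms(1)])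
    show "((\<lambda>x. matrix_inv (f x)) has_derivative
        (\<lambda>v. - (matrix_inv (f x) ** frechet_derivative f (at x) v ** matrix_inv (f x)))) (at x)"
      if "x \<in> S" for x
      using Suc.prems that by (intro has_derivative_matrix_inv C_diff_has_derivative inv)
    show "C_diff k S (\<lambda>x. - (matrix_inv (f x) ** frechet_derivative f (at x) v ** matrix_inv (f x)))" for v
    proof -
      have "C_diff k S (\<lambda>x. matrix_inv (f x))"
        by (intro Suc.IH C_diff_Suc_D[OF Suc.prems])
      moreover have "C_diff k S (\<lambda>x. frechet_derivative f (at x) v)"
        using Suc.prems by simp
      ultimately show ?thesis by (intro C_diff_minus C_diff_matrix_mult assms(1))
    qed
  qed
qed

lemma smooth_map_onI:
  assumes "open N" "S \<subseteq> N" "\<And>k. C_diff k N f"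
  shows "smooth_map_on S f"
  unfolding smooth_map_on_def using assms by blast

section \<open>Rank conditions are semialgebraic\<close>

text \<open>
  The Gram matrix of the rows with index in \<open>I\<close>, padded with the identity. The padding keeps the
  size fixed while \<open>I\<close> varies, so that all rank conditions are stated with one determinant.
\<close>

definition padded_gram :: "'n set \<Rightarrow> real^'n^'n \<Rightarrow> real^'n^'n" where
  "padded_gram I A = (\<chi> i j. if i \<in> I \<and> j \<in> I then row i A \<bullet> row j A else if i = j then 1 else 0)"

lemma padded_gram_mult:
  "(padded_gram I A *v x) $ i = (if i \<in> I then row i A \<bullet> (\<Sum>j\<in>I. x $ j *\<^sub>R row j A) else x $ i)"
proof -
  have "(padded_gram I A *v x) $ i = (\<Sum>j\<in>UNIV. padded_gram I A $ i $ j * x $ j)"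
    by (simp add: matrix_vector_mult_def)
  also have "\<dots> = (if i \<in> I then row i A \<bullet> (\<Sum>j\<in>I. x $ j *\<^sub>R row j A) else x $ i)"
  proof (cases "i \<in> I")
    case True
    have "(\<Sum>j\<in>UNIV. padded_gram I A $ i $ j * x $ j) = (\<Sum>j\<in>I. padded_gram I A $ i $ j * x $ j)"
      using True by (intro sum.mono_neutral_right) (auto simp: padded_gram_def)
    also have "\<dots> = (\<Sum>j\<in>I. x $ j * (row i A \<bullet> row j A))"
      using True by (intro sum.cong) (auto simp: padded_gram_def)
    finally show ?thesis using True by (simp add: inner_sum_right)
  next
    case False
    then have "(\<Sum>j\<in>UNIV. padded_gram I A $ i $ j * x $ j) = (\<Sum>j\<in>UNIV. if j = i then x $ i else 0)"
      by (intro sum.cong) (auto simp: padded_gram_def)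
    then show ?thesis using False by simp
  qed
  finally show ?thesis .
qed

text \<open>
  A kernel vector of a Gram matrix gives a linear combination of the rows that is orthogonal to
  itself. Independence is stated for the indexed family of rows, where a repeated row counts as a
  dependence.
\<close>

lemma padded_gram_det_nz_iff:
  "det (padded_gram I A) \<noteq> 0 \<longleftrightarrow> (\<forall>c. (\<Sum>j\<in>I. c j *\<^sub>R row j A) = 0 \<longrightarrow> (\<forall>j\<in>I. c j = 0))"
  (is "_ \<longleftrightarrow> ?indep")
proof -
  have ker: "det (padded_gram I A) \<noteq> 0 \<longleftrightarrow> (\<forall>x. padded_gram I A *v x = 0 \<longrightarrow> x = 0)"
    by (metis invertible_det_nz invertible_left_inverse matrix_left_invertible_ker)
  show ?thesis
    unfolding ker
  proof
    assume G: "\<forall>x. padded_gram I A *v x = 0 \<longrightarrow> x = 0"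
    show ?indep
    proof (intro allI impI ballI)
      fix c j assume c: "(\<Sum>j\<in>I. c j *\<^sub>R row j A) = 0" and j: "j \<in> I"
      define x where "x = (\<chi> i. if i \<in> I then c i else 0)"
      have "(\<Sum>j\<in>I. x $ j *\<^sub>R row j A) = 0"
        using c by (simp add: x_def cong: sum.cong)
      then have "padded_gram I A *v x = 0"
        by (subst vec_eq_iff) (auto simp: padded_gram_mult, simp add: x_def)
      then have "x = 0" using G by blast
      then have "x $ j = 0" by simp
      then show "c j = 0" using j by (simp add: x_def)
    qed
  next
    assume indep: ?indep
    show "\<forall>x. padded_gram I A *v x = 0 \<longrightarrow> x = 0"
    proof (intro allI impI)
      fix x assume x: "padded_gram I A *v x = 0"
      let ?v = "\<Sum>j\<in>I. x $ j *\<^sub>R row j A"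
      have out: "x $ i = 0" if "i \<notin> I" for i
        using x padded_gram_mult[of I A x i] that by simp
      have "row i A \<bullet> ?v = 0" if "i \<in> I" for i
        using x padded_gram_mult[of I A x i] that by simp
      then have "?v \<bullet> ?v = 0"
        by (subst inner_sum_left) simp
      then have "\<forall>j\<in>I. x $ j = 0" using indep by simp
      then show "x = 0" using out by (metis vec_eq_iff zero_index)
    qed
  qed
qed

lemma le_rank_iff_padded_gram:
  fixes A :: "real^'n^'n"
  shows "k \<le> rank A \<longleftrightarrow> (\<exists>I. card I = k \<and> det (padded_gram I A) \<noteq> 0)"
proof
  assume k: "k \<le> rank A"
  obtain B where B: "B \<subseteq> rows A" "independent B" "card B = rank A"
    unfolding row_rank_def by (metis basis_exists)
  then obtain B' where B': "B' \<subseteq> B" "card B' = k"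
    using k by (metis obtain_subset_with_card_n)
  have "B' \<subseteq> (\<lambda>i. row i A) ` UNIV" using B' B by (auto simp: rows_def)
  then obtain I where inj: "inj_on (\<lambda>i. row i A) I" and I: "B' = (\<lambda>i. row i A) ` I"
    by (auto simp: subset_image_inj)
  have ind: "independent B'" using B' B independent_mono by blast
  have "\<forall>j\<in>I. c j = 0" if c: "(\<Sum>j\<in>I. c j *\<^sub>R row j A) = 0" for c
  proof -
    define u where "u = c \<circ> the_inv_into I (\<lambda>i. row i A)"
    have u: "u (row i A) = c i" if "i \<in> I" for i
      using that inj by (simp add: u_def the_inv_into_f_f[OF inj, of i])
    have "(\<Sum>v\<in>B'. u v *\<^sub>R v) = (\<Sum>j\<in>I. u (row j A) *\<^sub>R row j A)"
      unfolding I by (simp add: sum.reindex[OF inj] o_def)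
    also have "\<dots> = 0" using c u by simp
    finally have "u v = 0" if "v \<in> B'" for v
      using independentD[OF ind _ subset_refl _ that] I by simp
    then show ?thesis using u I by auto
  qed
  then have "det (padded_gram I A) \<noteq> 0" by (simp add: padded_gram_det_nz_iff)
  moreover have "card I = k" using B' I inj card_image by metis
  ultimately show "\<exists>I. card I = k \<and> det (padded_gram I A) \<noteq> 0" by blast
next
  assume "\<exists>I. card I = k \<and> det (padded_gram I A) \<noteq> 0"
  then obtain I where I: "card I = k"
    and indep: "\<And>c. (\<Sum>j\<in>I. c j *\<^sub>R row j A) = 0 \<Longrightarrow> \<forall>j\<in>I. c j = 0"
    by (auto simp: padded_gram_det_nz_iff)
  have inj: "inj_on (\<lambda>i. row i A) I"
  proof (rule inj_onI, rule ccontr)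
    fix i j assume ij: "i \<in> I" "j \<in> I" "row i A = row j A" "i \<noteq> j"
    define c where "c l = (if l = i then 1 else 0) - (if l = j then 1 else (0::real))" for l
    have "(\<Sum>l\<in>I. c l *\<^sub>R row l A) = (\<Sum>l\<in>I. if l = i then row i A else 0) - (\<Sum>l\<in>I. if l = j then row j A else 0)"
      unfolding sum_subtractf[symmetric] by (intro sum.cong) (auto simp: c_def)
    also have "\<dots> = 0" using ij by simp
    finally have "c i = 0" using indep ij(1) by blast
    then show False using ij(4) by (simp add: c_def)
  qed
  have "independent ((\<lambda>i. row i A) ` I)"
  proof (rule independent_if_scalars_zero)
    fix u v assume u: "(\<Sum>v\<in>(\<lambda>i. row i A) ` I. u v *\<^sub>R v) = 0" and v: "v \<in> (\<lambda>i. row i A) ` I"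
    have "(\<Sum>j\<in>I. u (row j A) *\<^sub>R row j A) = 0"
      using u by (simp add: sum.reindex[OF inj] o_def)
    then show "u v = 0" using indep[of "\<lambda>j. u (row j A)"] v by auto
  qed simp
  moreover have "(\<lambda>i. row i A) ` I \<subseteq> rows A" by (auto simp: rows_def)
  ultimately have "card ((\<lambda>i. row i A) ` I) \<le> dim (rows A)"
    using independent_card_le_dim by blast
  then show "k \<le> rank A" using I inj by (simp add: card_image row_rank_def)
qed

lemma real_polynomial_function_entry:
  "real_polynomial_function (\<lambda>A :: real^'n^'m. A $ i $ j)"
  by (rule real_polynomial_function.intros(1))
    (rule bounded_linear_compose[OF bounded_linear_vec_nth[of j] bounded_linear_vec_nth[of i]])

lemma real_polynomial_function_det:
  fixes f :: "'a::euclidean_space \<Rightarrow> real^'n^'n"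
  assumes "\<And>i j. real_polynomial_function (\<lambda>x. f x $ i $ j)"
  shows "real_polynomial_function (\<lambda>x. det (f x))"
  unfolding det_def
proof (rule real_polynomial_function_sum)
  fix p :: "'n \<Rightarrow> 'n"
  have "real_polynomial_function (\<lambda>x. \<Prod>i\<in>UNIV. f x $ i $ p i)"
    by (rule real_polynomial_function_prod) (simp_all add: assms)
  then show "real_polynomial_function (\<lambda>x. of_int (sign p) * (\<Prod>i\<in>UNIV. f x $ i $ p i))"
    by (rule real_polynomial_function.intros(4)[OF real_polynomial_function.intros(2)])
qed simp

lemma real_polynomial_function_padded_gram:
  "real_polynomial_function (\<lambda>A :: real^'n^'n. det (padded_gram I A))"
proof (rule real_polynomial_function_det)
  fix i j
  have "real_polynomial_function (\<lambda>A :: real^'n^'n. row i A \<bullet> row j A)"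
    unfolding inner_vec_def row_def
    by (simp, intro real_polynomial_function_sum real_polynomial_function.intros(4)
        real_polynomial_function_entry) auto
  then show "real_polynomial_function (\<lambda>A :: real^'n^'n. padded_gram I A $ i $ j)"
    by (cases "i \<in> I \<and> j \<in> I") (auto simp: padded_gram_def intro: real_polynomial_function.intros(2))
qed

lemma semialgebraic_nonzero:
  assumes "real_polynomial_function f"
  shows "semialgebraic {x. f x \<noteq> 0}"
  using semialgebraic.Compl[OF semialgebraic.zero[OF assms]] by (simp add: Collect_neg_eq)

lemma semialgebraic_empty: "semialgebraic {}"
  using semialgebraic.zero[OF real_polynomial_function.intros(2)[of 1]] by simp

lemma semialgebraic_UN:
  assumes "finite F" "\<And>i. i \<in> F \<Longrightarrow> semialgebraic (S i)"
  shows "semialgebraic (\<Union>i\<in>F. S i)"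
  using assms by (induction F rule: finite_induct) (auto intro: semialgebraic_empty semialgebraic.Un)

lemma semialgebraic_le_rank: "semialgebraic {A :: real^'n^'n. k \<le> rank A}"
proof -
  have "{A :: real^'n^'n. k \<le> rank A} = (\<Union>I\<in>{I. card I = k}. {A. det (padded_gram I A) \<noteq> 0})"
    by (auto simp: le_rank_iff_padded_gram)
  then show ?thesis
    by (simp add: semialgebraic_UN semialgebraic_nonzero real_polynomial_function_padded_gram)
qed

text \<open>A sum of squares combines the linear equations into a single polynomial equation.\<close>

lemma semialgebraic_Skew: "semialgebraic (Skew :: (real^'n^'n) set)"
proof -
  have "A \<in> Skew \<longleftrightarrow> (\<forall>i j. A $ i $ j + A $ j $ i = 0)" for A :: "real^'n^'n"
  proof -
    have "(A $ i $ j + A $ j $ i = 0) = (A $ j $ i = - A $ i $ j)" for i j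
      by linarith
    then show ?thesis by (simp only: Skew_def transpose_def vec_eq_iff) simp
  qed
  then have "A \<in> Skew \<longleftrightarrow> (\<Sum>i\<in>UNIV. \<Sum>j\<in>UNIV. (A $ i $ j + A $ j $ i)\<^sup>2) = 0" for A :: "real^'n^'n"
    by (simp add: sum_nonneg_eq_0_iff sum_nonneg)
  then have eq: "Skew = {A :: real^'n^'n. (\<Sum>i\<in>UNIV. \<Sum>j\<in>UNIV. (A $ i $ j + A $ j $ i)\<^sup>2) = 0}"
    by blast
  have "real_polynomial_function
      (\<lambda>A :: real^'n^'n. \<Sum>i\<in>UNIV. \<Sum>j\<in>UNIV. (A $ i $ j + A $ j $ i)\<^sup>2)"
    by (intro real_polynomial_function_sum real_polynomial_function_power
        real_polynomial_function.intros(3) real_polynomial_function_entry) auto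
  then show ?thesis
    unfolding eq by (rule semialgebraic.zero)
qed

lemma semialgebraic_Skew_rank: "semialgebraic (Skew_rank k :: (real^'n^'n) set)"
proof -
  have "Skew_rank k = Skew \<inter> ({A :: real^'n^'n. k \<le> rank A} \<inter> - {A. Suc k \<le> rank A})"
    by (auto simp: Skew_rank_def)
  then show ?thesis
    by (simp only: semialgebraic.Int semialgebraic.Compl semialgebraic_Skew semialgebraic_le_rank)
qed

section \<open>Blocks of a skew-symmetric matrix relative to its kernel\<close>

lemmas matrix_ring_simps = matmul.add_left matmul.add_right matmul.diff_left matmul.diff_right
  matmul.minus_left matmul.minus_right matmul.zero_left matmul.zero_right matrix_mul_assoc

lemmas transpose_simps = matrix_transpose_mul transpose_add transpose_diff transpose_minus

text \<open>Products are normalized to left association; these rules apply an identity between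
  products of two or three factors inside a longer product.\<close>

lemma matrix_absorb2: "A ** B = C \<Longrightarrow> X ** A ** B = X ** C"
  for A :: "real^'b^'a" and B :: "real^'c^'b" and X :: "real^'a^'d"
  by (simp add: matrix_mul_assoc[symmetric])

lemma matrix_absorb3: "A ** B ** D = C \<Longrightarrow> X ** A ** B ** D = X ** C"
  for A :: "real^'b^'a" and B :: "real^'c^'b" and D :: "real^'e^'c" and X :: "real^'a^'d"
  by (simp add: matrix_mul_assoc[symmetric])

lemma SkewD: "A \<in> Skew \<Longrightarrow> transpose A = - A"
  by (simp add: Skew_def)

lemma rank_mult_invertible:
  fixes A G H :: "real^'n^'n"
  assumes "invertible G" "invertible H"
  shows "rank (G ** A ** H) = rank A"
proof (rule antisym)
  show "rank (G ** A ** H) \<le> rank A"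
    by (meson order_trans rank_mul_le_left rank_mul_le_right)
  have "A = matrix_inv G ** (G ** A ** H) ** matrix_inv H"
    by (simp add: matrix_mul_assoc matrix_inv_works assms)
      (simp add: matrix_mul_assoc[symmetric] matrix_inv_works assms)
  then show "rank A \<le> rank (G ** A ** H)"
    by (metis order_trans rank_mul_le_left rank_mul_le_right)
qed

lemma invertible_iff_kernel: "invertible A \<longleftrightarrow> (\<forall>x. A *v x = 0 \<longrightarrow> x = 0)" for A :: "real^'n^'n"
  by (metis invertible_left_inverse matrix_left_invertible_ker)

text \<open>
  For skew-symmetric \<open>p\<close> the range is the orthogonal complement of the kernel. If \<open>Q\<close> is the
  orthogonal projection onto the kernel and \<open>P = 1 - Q\<close>, then \<open>p\<close> lives in the block \<open>P p P\<close>, and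
  the other matrices near \<open>p\<close> are studied through their four blocks.
\<close>

locale kernel_projection =
  fixes p Q :: "real^'n^'n"
  assumes skew: "p \<in> Skew"
    and Q_sym: "transpose Q = Q"
    and pQ: "p ** Q = 0"
    and kernel_fixed: "p *v x = 0 \<Longrightarrow> Q *v x = x"
begin

definition P :: "real^'n^'n" where "P = mat 1 - Q"

text \<open>
  Padding the block \<open>P A P\<close> with the identity on the kernel of \<open>p\<close> expresses its invertibility on
  the range of \<open>p\<close> as invertibility of a full matrix. Removing the padding from the inverse gives
  the inverse of the block, extended by zero.
\<close>

definition core :: "real^'n^'n \<Rightarrow> real^'n^'n" where "core A = P ** A ** P + Q"

definition block_inv :: "real^'n^'n \<Rightarrow> real^'n^'n" where "block_inv A = matrix_inv (core A) - Q"

text \<open>The kernel block \<open>Q A Q\<close> minus this term is the Schur complement of the block \<open>P A P\<close>.\<close>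

definition schur_correction :: "real^'n^'n \<Rightarrow> real^'n^'n" where
  "schur_correction A = Q ** A ** block_inv A ** A ** Q"

text \<open>The pseudoinverse of \<open>p\<close>.\<close>

abbreviation R :: "real^'n^'n" where "R \<equiv> block_inv p"

lemma QQ: "Q ** Q = Q"
proof -
  have "p *v (Q *v x) = 0" for x by (simp add: matrix_vector_mul_assoc pQ)
  then have "Q *v (Q *v x) = Q *v x" for x by (rule kernel_fixed)
  then show ?thesis by (simp add: matrix_eq matrix_vector_mul_assoc)
qed

lemma Qp: "Q ** p = 0"
proof -
  have "transpose (p ** Q) = - (Q ** p)"
    by (simp add: transpose_simps Q_sym SkewD[OF skew] matrix_ring_simps)
  then show ?thesis by (simp add: pQ transpose_def vec_eq_iff)
qed

lemma PQ: "P ** Q = 0" and QP: "Q ** P = 0" and PP: "P ** P = P"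
  and Pp: "P ** p = p" and pP: "p ** P = p" and P_sym: "transpose P = P"
  unfolding P_def by (simp_all add: matrix_ring_simps QQ pQ Qp transpose_simps Q_sym)

lemmas proj_simps = QQ PQ QP PP pQ Qp Pp pP
  QQ[THEN matrix_absorb2] PQ[THEN matrix_absorb2] QP[THEN matrix_absorb2] PP[THEN matrix_absorb2]
  pQ[THEN matrix_absorb2] Qp[THEN matrix_absorb2] Pp[THEN matrix_absorb2] pP[THEN matrix_absorb2]

lemma core_p: "core p = p + Q"
  by (simp add: core_def proj_simps)

lemma invertible_core_p: "invertible (core p)"
  unfolding invertible_iff_kernel
proof (intro allI impI)
  fix x assume x: "core p *v x = 0"
  have "Q *v (core p *v x) = Q *v x"
    by (simp add: core_p matrix_vector_mul_assoc matrix_ring_simps proj_simps)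
  then have Qx: "Q *v x = 0" using x by simp
  then have "p *v x = 0"
    using x by (simp add: core_p matrix_vector_mult_add_rdistrib)
  then show "x = 0" using Qx kernel_fixed by metis
qed

lemma block_inv_props:
  assumes "invertible (core A)"
  shows "Q ** block_inv A = 0" "block_inv A ** Q = 0"
    "P ** block_inv A = block_inv A" "block_inv A ** P = block_inv A"
    "P ** A ** block_inv A = P" "block_inv A ** A ** P = P"
proof -
  define N where "N = matrix_inv (core A)"
  have N: "core A ** N = mat 1" "N ** core A = mat 1"
    unfolding N_def by (simp_all add: matrix_inv_works assms)
  have c: "Q ** core A = Q" "core A ** Q = Q"
    by (simp_all add: core_def matrix_ring_simps proj_simps)
  have QN: "Q ** N = Q"
    using arg_cong[OF N(1), of "\<lambda>X. Q ** X"] by (simp add: matrix_mul_assoc c)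
  have NQ: "N ** Q = Q"
    using arg_cong[OF N(2), of "\<lambda>X. X ** Q"] by (simp add: matrix_mul_assoc[symmetric] c)
  show Q: "Q ** block_inv A = 0" "block_inv A ** Q = 0"
    by (simp_all add: block_inv_def N_def[symmetric] matrix_ring_simps QN NQ QQ)
  then show P: "P ** block_inv A = block_inv A" "block_inv A ** P = block_inv A"
    by (simp_all add: P_def matrix_ring_simps)
  have "P ** A ** P ** block_inv A = P ** core A ** block_inv A"
    by (simp add: core_def matrix_ring_simps proj_simps Q)
  also have "\<dots> = P ** (core A ** N) - P ** (core A ** Q)"
    by (simp add: block_inv_def N_def matrix_ring_simps)
  also have "\<dots> = P" by (simp add: N c proj_simps)
  finally show "P ** A ** block_inv A = P"
    by (simp add: matrix_mul_assoc[symmetric] P)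
  have "block_inv A ** P ** A ** P = block_inv A ** core A ** P"
    by (simp add: core_def matrix_ring_simps proj_simps Q)
  also have "\<dots> = (N ** core A) ** P - (Q ** core A) ** P"
    by (simp add: block_inv_def N_def matrix_ring_simps)
  also have "\<dots> = P" by (simp add: N c proj_simps)
  finally show "block_inv A ** A ** P = P"
    by (simp add: P)
qed

text \<open>A two-sided inverse on the range of \<open>p\<close> is unique, and \<open>- B\<^sup>T\<close> is another one.\<close>

lemma block_inv_skew:
  assumes inv: "invertible (core A)" and A: "A \<in> Skew"
  shows "transpose (block_inv A) = - block_inv A"
proof -
  let ?B = "block_inv A"
  note B = block_inv_props[OF inv]
  have 1: "transpose ?B ** P = transpose ?B"
    using arg_cong[OF B(3), of transpose] by (simp add: transpose_simps P_sym)
  have 2: "transpose ?B ** A ** P = - P"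
  proof -
    have "transpose ?B ** transpose A ** P = P"
      using arg_cong[OF B(5), of transpose] by (simp add: transpose_simps P_sym matrix_mul_assoc)
    then have "- (transpose ?B ** A ** P) = P"
      by (simp add: SkewD[OF A] matrix_ring_simps)
    then show ?thesis by (metis minus_minus)
  qed
  have "transpose ?B = transpose ?B ** (P ** A ** ?B)"
    by (simp add: B 1)
  also have "\<dots> = transpose ?B ** A ** (P ** ?B)"
    by (simp only: B(3)) (simp only: matrix_mul_assoc 1)
  also have "\<dots> = - ?B"
    by (simp only: matrix_mul_assoc 2) (simp add: matrix_ring_simps B)
  finally show ?thesis .
qed

lemmas R_props = block_inv_props[OF invertible_core_p]

lemma R_skew: "transpose R = - R"
  by (rule block_inv_skew[OF invertible_core_p skew])

lemma pR: "p ** R = P" and Rp: "R ** p = P"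
  using R_props(5,6) by (simp_all add: Pp pP matrix_mul_assoc[symmetric])

lemma rank_p: "rank p = rank P"
  by (metis Rp pP antisym rank_mul_le_left rank_mul_le_right)

lemma schur_correction_skew:
  assumes "invertible (core A)" "A \<in> Skew"
  shows "transpose (schur_correction A) = - schur_correction A"
  unfolding schur_correction_def
  by (simp add: transpose_simps Q_sym SkewD[OF assms(2)] block_inv_skew[OF assms] matrix_ring_simps)

lemma schur_correction_block: "Q ** schur_correction A ** Q = schur_correction A"
  "P ** schur_correction A = 0" "schur_correction A ** P = 0"
  unfolding schur_correction_def by (simp_all add: matrix_ring_simps proj_simps)

text \<open>
  Congruence with the unipotent matrix \<open>1 + Q A B\<close>, where \<open>B\<close> inverts the block \<open>P A P\<close>, makes
  \<open>A\<close> block diagonal with blocks \<open>P A P\<close>, of full rank, and the Schur complement.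
\<close>

lemma rank_eq_iff_schur:
  assumes inv: "invertible (core A)" and A: "A \<in> Skew"
  shows "rank A = rank p \<longleftrightarrow> Q ** A ** Q = schur_correction A"
proof -
  let ?B = "block_inv A"
  note B = block_inv_props[OF inv]
  note B2 = B(1-4)[THEN matrix_absorb2] B(5,6)[THEN matrix_absorb3]
  define S where "S = Q ** A ** Q - schur_correction A"
  define Z where "Z = P ** A ** P + S"
  define G where "G = mat 1 + Q ** A ** ?B"
  have S: "P ** S = 0" "S ** P = 0" "Q ** S = S" "S ** Q = S" "?B ** S = 0" "S ** ?B = 0"
    unfolding S_def schur_correction_def by (simp_all add: matrix_ring_simps proj_simps B B2)
  note S2 = S[THEN matrix_absorb2]
  have Gt: "transpose G = mat 1 + ?B ** A ** Q"
    unfolding G_def by (simp add: transpose_simps Q_sym SkewD[OF A] block_inv_skew[OF inv A] matrix_ring_simps)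
  have "G ** (mat 1 - Q ** A ** ?B) = mat 1"
    unfolding G_def by (simp add: matrix_ring_simps B B2)
  then have G: "invertible G"
    using invertible_right_inverse by blast
  have "G ** Z = P ** A ** P + S + Q ** A ** P"
    unfolding G_def Z_def by (simp add: matrix_ring_simps B B2 S S2 proj_simps)
  then have "G ** Z ** transpose G = P ** A ** P + S + Q ** A ** P + P ** A ** Q + schur_correction A"
    unfolding Gt schur_correction_def
    by (simp add: matrix_ring_simps B B2 S S2 proj_simps)
  also have "\<dots> = A"
    unfolding S_def by (simp add: P_def matrix_ring_simps)
  finally have rA: "rank A = rank Z"
    using rank_mult_invertible[OF G, of "transpose G" Z] G by (simp add: invertible_transpose_iff)
  have "rank Z = rank P \<longleftrightarrow> S = 0"
  proof
    assume r: "rank Z = rank P"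
    \<comment> \<open>\<open>Z\<close> reaches the whole range of \<open>P\<close>, so rank equality leaves no room for \<open>S\<close>.\<close>
    have ZB: "Z ** ?B = P"
      unfolding Z_def by (simp add: matrix_ring_simps B B2 S S2)
    have "range ((*v) P) = range ((*v) Z)"
    proof (rule subspace_dim_equal)
      show "range ((*v) P) \<subseteq> range ((*v) Z)"
        unfolding ZB[symmetric] by (auto simp: matrix_vector_mul_assoc[symmetric])
      show "dim (range ((*v) Z)) \<le> dim (range ((*v) P))"
        using r by (simp add: rank_dim_range)
    qed (auto intro!: linear_subspace_image)
    then have "Q *v (Z *v x) = 0" for x
    proof -
      obtain y where "Z *v x = P *v y"
        using \<open>range ((*v) P) = range ((*v) Z)\<close> by (metis rangeE rangeI)
      then show ?thesis by (simp add: matrix_vector_mul_assoc QP)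
    qed
    then have "Q ** Z = 0" by (simp add: matrix_eq matrix_vector_mul_assoc)
    moreover have "Q ** Z = S"
      unfolding Z_def by (simp add: matrix_ring_simps proj_simps S)
    ultimately show "S = 0" by simp
  next
    assume "S = 0"
    then have "Z = mat 1 ** P ** core A"
      by (simp add: Z_def core_def matrix_ring_simps proj_simps)
    moreover have "invertible (mat 1 :: real^'n^'n)"
      unfolding invertible_def by (metis matrix_mul_lid)
    ultimately show "rank Z = rank P"
      using rank_mult_invertible[OF _ inv, of "mat 1" P] by simp
  qed
  then show ?thesis
    using rA rank_p by (simp add: S_def)
qed

end

lemma kernel_projection_exists:
  fixes p :: "real^'n^'n"
  assumes "p \<in> Skew"
  shows "\<exists>Q. kernel_projection p Q"
proof -
  define K where "K = {x. p *v x = 0}"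
  have K: "subspace K"
    unfolding K_def by (auto simp: subspace_def matrix_vector_right_distrib matrix_vector_mult_scaleR)
  obtain B where B: "orthonormal_basis K B"
    using orthonormal_basis_exists[OF K] by blast
  define Q :: "real^'n^'n" where "Q = (\<chi> i j. \<Sum>b\<in>B. b $ i * b $ j)"
  have Qv: "Q *v x = (\<Sum>b\<in>B. (x \<bullet> b) *\<^sub>R b)" for x
  proof (rule iffD2[OF vec_eq_iff], intro allI)
    fix i
    have "(Q *v x) $ i = (\<Sum>j\<in>UNIV. \<Sum>b\<in>B. b $ i * b $ j * x $ j)"
      by (simp add: Q_def matrix_vector_mult_def sum_distrib_right)
    also have "\<dots> = (\<Sum>b\<in>B. \<Sum>j\<in>UNIV. b $ i * b $ j * x $ j)"
      by (rule sum.swap)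
    also have "\<dots> = (\<Sum>b\<in>B. (x \<bullet> b) *\<^sub>R b) $ i"
      by (simp add: inner_vec_def sum_distrib_left sum_distrib_right algebra_simps)
    finally show "(Q *v x) $ i = (\<Sum>b\<in>B. (x \<bullet> b) *\<^sub>R b) $ i" .
  qed
  have "kernel_projection p Q"
  proof
    show "p \<in> Skew" by fact
    show "transpose Q = Q"
      by (simp add: Q_def transpose_def vec_eq_iff mult.commute)
    have "p *v b = 0" if "b \<in> B" for b
      using B that unfolding orthonormal_basis_def K_def by blast
    then have "p *v (Q *v x) = 0" for x
      unfolding Qv by (simp add: linear_sum[OF matrix_vector_mul_linear] matrix_vector_mult_scaleR o_def)
    then show "p ** Q = 0"
      by (simp add: matrix_eq matrix_vector_mul_assoc)
    show "Q *v x = x" if "p *v x = 0" for x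
      using orthonormal_basis_expand(2)[OF B, of x] that unfolding Qv K_def by simp
  qed
  then show ?thesis ..
qed

section \<open>Traces over a subspace\<close>

text \<open>
  Expanding each basis vector of \<open>T\<close> in the standard basis turns the trace over \<open>T\<close> into a sum
  over the standard basis in which \<open>T\<close> enters only through its orthogonal projection \<open>\<pi>\<close>.
\<close>

lemma sum_orthonormal_basis:
  fixes T :: "'a::euclidean_space set" and f :: "'a \<Rightarrow> 'a \<Rightarrow> 'b::real_normed_vector"
  assumes B: "orthonormal_basis T B" and f: "bounded_bilinear f"
    and proj: "\<And>x. \<pi> x \<in> T" "\<And>x t. t \<in> T \<Longrightarrow> (x - \<pi> x) \<bullet> t = 0"
  shows "(\<Sum>e\<in>B. f e e) = (\<Sum>b\<in>Basis. f (\<pi> b) b)"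
proof -
  interpret bounded_bilinear f by (rule f)
  have BT: "e \<in> T" if "e \<in> B" for e using B that by (auto simp: orthonormal_basis_def)
  have \<pi>: "\<pi> b = (\<Sum>e\<in>B. (b \<bullet> e) *\<^sub>R e)" for b
  proof -
    have "\<pi> b = (\<Sum>e\<in>B. (\<pi> b \<bullet> e) *\<^sub>R e)"
      by (rule orthonormal_basis_expand(2)[OF B proj(1)])
    also have "\<dots> = (\<Sum>e\<in>B. (b \<bullet> e) *\<^sub>R e)"
      using proj(2)[OF BT, of _ b] by (intro sum.cong) (auto simp: inner_diff_left)
    finally show ?thesis .
  qed
  have "(\<Sum>e\<in>B. f e e) = (\<Sum>e\<in>B. f e (\<Sum>b\<in>Basis. (e \<bullet> b) *\<^sub>R b))"
    by (simp add: euclidean_representation)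
  also have "\<dots> = (\<Sum>e\<in>B. \<Sum>b\<in>Basis. (e \<bullet> b) *\<^sub>R f e b)"
    by (simp add: sum_right scaleR_right)
  also have "\<dots> = (\<Sum>b\<in>Basis. \<Sum>e\<in>B. (e \<bullet> b) *\<^sub>R f e b)"
    by (rule sum.swap)
  also have "\<dots> = (\<Sum>b\<in>Basis. f (\<pi> b) b)"
    unfolding \<pi> by (simp add: sum_left scaleR_left inner_commute)
  finally show ?thesis .
qed

lemma orthonormal_basis_card:
  assumes "orthonormal_basis T B"
  shows "card B = dim T"
proof -
  have "0 \<notin> B" "pairwise orthogonal B" and sp: "span B = T"
    using assms by (auto simp: orthonormal_basis_def)
  then have "independent B" using pairwise_orthogonal_independent by blast
  then show ?thesis using sp dim_eq_card_independent dim_span by metis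
qed

lemma dim_eq_sum_Basis:
  fixes T :: "'a::euclidean_space set"
  assumes T: "subspace T"
    and proj: "\<And>x. \<pi> x \<in> T" "\<And>x t. t \<in> T \<Longrightarrow> (x - \<pi> x) \<bullet> t = 0"
  shows "real (dim T) = (\<Sum>b\<in>Basis. \<pi> b \<bullet> b)"
proof -
  obtain B where B: "orthonormal_basis T B"
    using orthonormal_basis_exists[OF T] by blast
  have "(\<Sum>e\<in>B. e \<bullet> e) = (\<Sum>e\<in>B. 1)"
    using B by (intro sum.cong) (auto simp: orthonormal_basis_def dot_square_norm)
  then show ?thesis
    using sum_orthonormal_basis[OF B bounded_bilinear_inner proj] orthonormal_basis_card[OF B]
    by simp
qed

lemma sum_Basis_vec: "(\<Sum>b\<in>Basis. g b) = (\<Sum>i\<in>UNIV. \<Sum>u\<in>Basis. g (axis i u))"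
  for g :: "'a::euclidean_space^'n \<Rightarrow> 'b::comm_monoid_add"
proof -
  have "(Basis :: ('a^'n) set) = (\<lambda>(i, u). axis i u) ` (UNIV \<times> Basis)"
    by (auto simp: Basis_vec_def)
  moreover have "inj_on (\<lambda>(i, u). axis i u) ((UNIV :: 'n set) \<times> (Basis :: 'a set))"
    by (auto simp: inj_on_def axis_eq_axis)
  ultimately have "(\<Sum>b\<in>Basis. g b) = (\<Sum>x\<in>UNIV \<times> Basis. g (case x of (i, u) \<Rightarrow> axis i u))"
    by (metis (no_types, lifting) sum.reindex_cong)
  also have "\<dots> = (\<Sum>(i, u)\<in>UNIV \<times> Basis. g (axis i u))"
    by (simp add: case_prod_unfold)
  finally show ?thesis
    by (simp add: sum.cartesian_product)
qed

lemma sum_Basis_matrix: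
  "(\<Sum>b\<in>Basis. g b) = (\<Sum>i\<in>UNIV. \<Sum>j\<in>UNIV. g (axis i (axis j 1)))"
  for g :: "real^'n^'m \<Rightarrow> 'b::comm_monoid_add"
  by (simp add: sum_Basis_vec)

lemma matrix_unit_entry:
  "(axis i (axis j 1) :: real^'n^'m) $ k $ l = (if k = i \<and> l = j then 1 else 0)"
  by (simp add: axis_def)

lemma matrix_unit_mult:
  fixes X :: "real^'m^'a" and Y :: "real^'b^'n"
  shows "(X ** axis i (axis j 1) ** Y) $ k $ l = X $ k $ i * Y $ j $ l"
proof -
  have XE: "(X ** axis i (axis j 1)) $ k $ m = (if m = j then X $ k $ i else 0)" for m
    by (cases "m = j") (simp_all add: matrix_matrix_mult_def matrix_unit_entry if_distrib cong: if_cong)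
  have "(X ** axis i (axis j 1) ** Y) $ k $ l = (\<Sum>m\<in>UNIV. (if m = j then X $ k $ i else 0) * Y $ m $ l)"
    unfolding matrix_matrix_mult_def[of "X ** axis i (axis j 1)"] by (simp only: vec_lambda_beta XE)
  also have "\<dots> = (\<Sum>m\<in>UNIV. if m = j then X $ k $ i * Y $ m $ l else 0)"
    by (intro sum.cong) auto
  finally show ?thesis by simp
qed

lemma transpose_matrix_unit: "transpose (axis i (axis j 1) :: real^'n^'m) = axis j (axis i 1)"
  by (auto simp: transpose_def axis_def vec_eq_iff)

lemma inner_matrix_unit: "(X :: real^'n^'m) \<bullet> axis i (axis j 1) = X $ i $ j"
  by (simp add: inner_axis)

lemma inner_transpose: "transpose A \<bullet> transpose B = A \<bullet> B" for A B :: "real^'n^'m"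
  unfolding inner_vec_def transpose_def by (simp, rule sum.swap)

lemma inner_symmetric_conjugate:
  fixes A B S :: "real^'n^'n"
  assumes "transpose S = S"
  shows "(S ** A ** S) \<bullet> B = A \<bullet> (S ** B ** S)"
proof -
  have "trace (S ** (transpose A ** S ** B)) = trace (transpose A ** S ** B ** S)"
    by (rule trace_mul_sym)
  then show ?thesis
    by (simp add: inner_eq_Frobenius transpose_simps assms matrix_mul_assoc)
qed

text \<open>The orthogonal projection onto the skew-symmetric matrices.\<close>

definition skew_part :: "real^'n^'n \<Rightarrow> real^'n^'n" where
  "skew_part A = (1 / 2) *\<^sub>R (A - transpose A)"

lemma skew_part_in_Skew: "skew_part A \<in> Skew"
  by (simp add: skew_part_def Skew_def transpose_simps transpose_scalar scaleR_diff_right)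

lemma skew_part_inner:
  assumes "t \<in> Skew"
  shows "skew_part A \<bullet> t = A \<bullet> t"
proof -
  have "transpose A \<bullet> t = A \<bullet> transpose t"
    using inner_transpose[of A "transpose t"] by simp
  then show ?thesis
    by (simp add: skew_part_def inner_diff_left SkewD[OF assms])
qed

context kernel_projection
begin

section \<open>The chart given by the Schur complement\<close>

text \<open>The model space of the chart, later identified with the tangent space at \<open>p\<close>.\<close>

definition tangent_model :: "(real^'n^'n) set" where
  "tangent_model = {B \<in> Skew. Q ** B ** Q = 0}"

definition tangent_projection :: "real^'n^'n \<Rightarrow> real^'n^'n" where
  "tangent_projection A = skew_part A - Q ** skew_part A ** Q"

lemma subspace_tangent_model: "subspace tangent_model"
  using subspace_Skew unfolding tangent_model_def subspace_def
  by (auto simp: matrix_ring_simps matmul.scaleR_left matmul.scaleR_right)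

lemma conjugate_Q_Skew: "A \<in> Skew \<Longrightarrow> Q ** A ** Q \<in> Skew"
  by (simp add: Skew_def transpose_simps Q_sym matrix_ring_simps)

lemma tangent_projection_mem: "tangent_projection A \<in> tangent_model"
  using subspace_diff[OF subspace_Skew skew_part_in_Skew conjugate_Q_Skew[OF skew_part_in_Skew]]
  unfolding tangent_model_def tangent_projection_def by (simp add: matrix_ring_simps proj_simps)

lemma tangent_projection_orthogonal:
  assumes "t \<in> tangent_model"
  shows "(A - tangent_projection A) \<bullet> t = 0"
proof -
  have t: "t \<in> Skew" "Q ** t ** Q = 0" using assms by (auto simp: tangent_model_def)
  have "tangent_projection A \<bullet> t = skew_part A \<bullet> t - skew_part A \<bullet> (Q ** t ** Q)"
    by (simp add: tangent_projection_def inner_diff_left inner_symmetric_conjugate[OF Q_sym])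
  then show ?thesis
    by (simp add: t inner_diff_left skew_part_inner)
qed

text \<open>The trace of \<open>P\<close> is the dimension of the range of \<open>P\<close>, which is the rank of \<open>p\<close>.\<close>

lemma trace_Q: "trace Q = real CARD('n) - real (rank p)"
proof -
  have "real (dim (range ((*v) P))) = (\<Sum>b\<in>Basis. (P *v b) \<bullet> b)"
  proof (rule dim_eq_sum_Basis)
    show "(x - P *v x) \<bullet> t = 0" if "t \<in> range ((*v) P)" for x t
    proof -
      obtain y where t: "t = P *v y" using \<open>t \<in> range ((*v) P)\<close> by blast
      have "(x - P *v x) \<bullet> t = (transpose P *v (x - P *v x)) \<bullet> y"
        unfolding t by (simp add: dot_lmul_matrix)
      also have "transpose P *v (x - P *v x) = 0"
        unfolding P_sym
        by (simp add: matrix_vector_mult_diff_distrib matrix_vector_mul_assoc PP)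
      finally show ?thesis by simp
    qed
  qed (auto intro!: linear_subspace_image)
  also have "\<dots> = trace P"
    by (simp add: sum_Basis_vec trace_def inner_axis matrix_vector_mult_basis column_def)
  finally have "real (rank p) = trace P"
    unfolding rank_p by (simp add: rank_dim_range)
  also have "\<dots> = real CARD('n) - trace Q"
    by (simp add: P_def trace_sub trace_I)
  finally show ?thesis by simp
qed

text \<open>
  The dimension of the model space is the trace of its orthogonal projection, which depends on
  the rank only. Thus all charts have the same dimension.
\<close>

lemma dim_tangent_model:
  "real (dim tangent_model) =
     ((real CARD('n))\<^sup>2 - real CARD('n) - (trace Q)\<^sup>2 + trace Q) / 2"
proof -
  have entry: "tangent_projection (axis i (axis j 1)) $ i $ j =
      (1 - (if i = j then 1 else 0) - Q $ i $ i * Q $ j $ j + Q $ i $ j * Q $ j $ i) / 2" for i j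
  proof -
    let ?E = "axis i (axis j 1) :: real^'n^'n" and ?E' = "axis j (axis i 1) :: real^'n^'n"
    have "tangent_projection ?E = (1 / 2) *\<^sub>R (?E - ?E' - Q ** ?E ** Q + Q ** ?E' ** Q)"
      by (simp add: tangent_projection_def skew_part_def transpose_matrix_unit matrix_ring_simps
          matmul.scaleR_left matmul.scaleR_right algebra_simps)
    moreover have "Q $ j $ i = Q $ i $ j"
      using arg_cong[OF Q_sym, of "\<lambda>M. M $ i $ j"] by (simp add: transpose_def)
    ultimately show ?thesis
      by (simp add: matrix_unit_mult matrix_unit_entry)
  qed
  have "real (dim tangent_model) = (\<Sum>i\<in>UNIV. \<Sum>j\<in>UNIV.
      (1 - (if i = j then 1 else 0) - Q $ i $ i * Q $ j $ j + Q $ i $ j * Q $ j $ i) / 2)"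
    using dim_eq_sum_Basis[OF subspace_tangent_model tangent_projection_mem tangent_projection_orthogonal]
    by (simp only: sum_Basis_matrix inner_matrix_unit entry)
  also have "\<dots> = ((\<Sum>i\<in>(UNIV::'n set). \<Sum>j\<in>(UNIV::'n set). 1)
      - (\<Sum>i\<in>(UNIV::'n set). \<Sum>j\<in>UNIV. if i = j then 1 else 0)
      - (\<Sum>i\<in>UNIV. \<Sum>j\<in>UNIV. Q $ i $ i * Q $ j $ j)
      + (\<Sum>i\<in>UNIV. \<Sum>j\<in>UNIV. Q $ i $ j * Q $ j $ i)) / 2"
    by (simp only: sum_divide_distrib[symmetric] sum.distrib sum_subtractf)
  also have "(\<Sum>i\<in>UNIV. \<Sum>j\<in>UNIV. Q $ i $ i * Q $ j $ j) = (trace Q)\<^sup>2"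
    by (simp add: trace_def power2_eq_square sum_product)
  also have "(\<Sum>i\<in>UNIV. \<Sum>j\<in>UNIV. Q $ i $ j * Q $ j $ i) = trace (Q ** Q)"
    by (simp add: trace_def matrix_matrix_mult_def)
  finally show ?thesis
    by (simp add: QQ power2_eq_square)
qed

lemma continuous_core: "continuous_on UNIV core"
  unfolding core_def
  by (intro continuous_intros matmul.continuous_on)

lemma open_core: "open {A. invertible (core A)}"
  by (rule open_invertible[OF continuous_core])

lemma C_diff_schur_correction: "C_diff k {A. invertible (core A)} schur_correction"
proof -
  have id: "C_diff k S (\<lambda>A :: real^'n^'n. A)" for S
    by (rule C_diff_bounded_linear) (rule bounded_linear_ident)
  have "C_diff k {A. invertible (core A)} core"
    unfolding core_def
    by (intro C_diff_add C_diff_matrix_mult C_diff_const id open_core[unfolded core_def])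
  then have "C_diff k {A. invertible (core A)} (\<lambda>A. matrix_inv (core A) + (- Q))"
    by (intro C_diff_add C_diff_matrix_inv C_diff_const open_core) auto
  then have "C_diff k {A. invertible (core A)} block_inv"
    by (simp add: block_inv_def[abs_def])
  then show ?thesis
    unfolding schur_correction_def
    by (intro C_diff_matrix_mult C_diff_const id open_core)
qed

lemma core_shift: "P ** C = 0 \<Longrightarrow> core (A + C) = core A"
  by (simp add: core_def matrix_ring_simps)

lemma schur_correction_shift:
  assumes inv: "invertible (core A)" and C: "P ** C = 0" "C ** P = 0"
  shows "schur_correction (A + C) = schur_correction A"
proof -
  have B: "block_inv (A + C) = block_inv A"
    by (simp add: block_inv_def core_shift[OF C(1)])
  have "C ** block_inv A = (C ** P) ** block_inv A"
    by (simp add: matrix_mul_assoc[symmetric] block_inv_props[OF inv])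
  then have CB: "C ** block_inv A = 0" by (simp add: C matrix_ring_simps)
  have "block_inv A ** C = block_inv A ** (P ** C)"
    by (simp add: matrix_mul_assoc block_inv_props[OF inv])
  then have BC: "block_inv A ** C = 0" by (simp add: C matrix_ring_simps)
  show ?thesis
    unfolding schur_correction_def B
    by (simp add: matrix_ring_simps CB BC CB[THEN matrix_absorb2] BC[THEN matrix_absorb2])
qed

text \<open>
  Near \<open>p\<close> the rank is constant exactly where the Schur complement vanishes. Subtracting the
  correction term of the Schur complement from the kernel block therefore straightens the rank
  stratum. The correction does not involve the kernel block, so adding it back is the inverse.
\<close>

lemma schur_chart:
  fixes U defines "U \<equiv> {A \<in> Skew. invertible (core A)}"
  shows "openin (top_of_set Skew) U" "p \<in> U"
    "diffeomorphism U U (\<lambda>A. A - schur_correction A) (\<lambda>A. A + schur_correction A)"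
    "(\<lambda>A. A - schur_correction A) ` (Skew_rank (rank p) \<inter> U) = tangent_model \<inter> U"
proof -
  define N where "N = {A. invertible (core A)}"
  let ?\<phi> = "\<lambda>A. A - schur_correction A" and ?\<psi> = "\<lambda>A. A + schur_correction A"
  have N: "open N" "U = Skew \<inter> N" unfolding N_def U_def using open_core by auto
  then show "openin (top_of_set Skew) U" by (auto simp: openin_open)
  show "p \<in> U" unfolding U_def using skew invertible_core_p by simp
  have sc: "C_diff k N schur_correction" for k
    unfolding N_def by (rule C_diff_schur_correction)
  have id: "C_diff k N (\<lambda>A. A)" for k
    by (rule C_diff_bounded_linear) (rule bounded_linear_ident)
  have \<phi>: "C_diff k N ?\<phi>" for k
    using C_diff_add[OF N(1) id C_diff_minus[OF N(1) sc]] by simp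
  have \<psi>: "C_diff k N ?\<psi>" for k
    by (rule C_diff_add[OF N(1) id sc])
  have core: "core (?\<phi> A) = core A" "core (?\<psi> A) = core A" for A
    using core_shift[of "- schur_correction A" A] core_shift[of "schur_correction A" A]
    by (simp_all add: matrix_ring_simps schur_correction_block)
  have scS: "schur_correction A \<in> Skew" if "A \<in> U" for A
    using that schur_correction_skew unfolding U_def Skew_def by simp
  have maps: "?\<phi> A \<in> U" "?\<psi> A \<in> U" if "A \<in> U" for A
    using that scS[OF that] subspace_diff[OF subspace_Skew] subspace_add[OF subspace_Skew]
    unfolding U_def by (auto simp: core)
  have shift: "schur_correction (?\<phi> A) = schur_correction A" "schur_correction (?\<psi> A) = schur_correction A"
    if "A \<in> U" for A
    using that schur_correction_shift[of A "- schur_correction A"]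
      schur_correction_shift[of A "schur_correction A"]
    unfolding U_def by (simp_all add: matrix_ring_simps schur_correction_block)
  have inverse: "?\<psi> (?\<phi> A) = A" "?\<phi> (?\<psi> A) = A" if "A \<in> U" for A
    using shift[OF that] by simp_all
  have "homeomorphism U U ?\<phi> ?\<psi>"
  proof (rule homeomorphismI)
    show "continuous_on U ?\<phi>" "continuous_on U ?\<psi>"
      using \<phi>[of 0] \<psi>[of 0] N(2) by (auto intro: continuous_on_subset)
  qed (use maps inverse in auto)
  then show "diffeomorphism U U ?\<phi> ?\<psi>"
    unfolding diffeomorphism_def using smooth_map_onI[OF N(1) _ \<phi>] smooth_map_onI[OF N(1) _ \<psi>] N(2)
    by blast
  have rank_iff: "A \<in> Skew_rank (rank p) \<longleftrightarrow> ?\<phi> A \<in> tangent_model" if "A \<in> U" for A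
    using that maps(1)[OF that] rank_eq_iff_schur[of A]
    unfolding U_def Skew_rank_def tangent_model_def
    by (simp add: matrix_ring_simps schur_correction_block)
  show "?\<phi> ` (Skew_rank (rank p) \<inter> U) = tangent_model \<inter> U"
  proof
    show "?\<phi> ` (Skew_rank (rank p) \<inter> U) \<subseteq> tangent_model \<inter> U"
      using rank_iff maps by blast
    show "tangent_model \<inter> U \<subseteq> ?\<phi> ` (Skew_rank (rank p) \<inter> U)"
    proof
      fix B assume B: "B \<in> tangent_model \<inter> U"
      then have BU: "B \<in> U" by simp
      have "?\<psi> B \<in> Skew_rank (rank p) \<inter> U"
        using rank_iff[OF maps(2)[OF BU]] inverse(2)[OF BU] maps(2)[OF BU] B by simp
      then show "B \<in> ?\<phi> ` (Skew_rank (rank p) \<inter> U)"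
        by (intro image_eqI[where x = "?\<psi> B"] inverse(2)[OF BU, symmetric])
    qed
  qed
qed

end

lemma embedded_submanifold_Skew_rank:
  "\<exists>d. embedded_submanifold (Skew :: (real^'n^'n) set) d (Skew_rank k)"
proof -
  \<comment> \<open>The dimension is \<open>dim Skew\<^sub>n - dim Skew\<^sub>t\<close>, where \<open>t = n - k\<close> is the dimension of the kernel.\<close>
  define t where "t = real CARD('n) - real k"
  define d where "d = nat \<lfloor>((real CARD('n))\<^sup>2 - real CARD('n) - t\<^sup>2 + t) / 2\<rfloor>"
  have "embedded_submanifold (Skew :: (real^'n^'n) set) d (Skew_rank k)"
    unfolding embedded_submanifold_def
  proof (intro conjI ballI)
    show "Skew_rank k \<subseteq> (Skew :: (real^'n^'n) set)" by (auto simp: Skew_rank_def)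
    fix p :: "real^'n^'n" assume p: "p \<in> Skew_rank k"
    then obtain Q where "kernel_projection p Q"
      using kernel_projection_exists[of p] by (auto simp: Skew_rank_def)
    then interpret kernel_projection p Q .
    have k: "rank p = k" using p by (simp add: Skew_rank_def)
    have "real (dim tangent_model) = ((real CARD('n))\<^sup>2 - real CARD('n) - t\<^sup>2 + t) / 2"
      using dim_tangent_model unfolding trace_Q k t_def .
    then have dim: "dim tangent_model = d" unfolding d_def by linarith
    have sub: "tangent_model \<subseteq> Skew" by (auto simp: tangent_model_def)
    show "\<exists>U W L (\<phi> :: real^'n^'n \<Rightarrow> real^'n^'n) \<psi>. openin (top_of_set Skew) U \<and> p \<in> U \<and> openin (top_of_set Skew) W \<and>
        diffeomorphism U W \<phi> \<psi> \<and> subspace L \<and> L \<subseteq> Skew \<and> dim L = d \<and>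
        \<phi> ` (Skew_rank k \<inter> U) = L \<inter> W"
      by (intro exI conjI, rule schur_chart(1), rule schur_chart(2), rule schur_chart(1),
          rule schur_chart(3), rule subspace_tangent_model, rule sub, rule dim,
          rule schur_chart(4)[unfolded k])
  qed
  then show ?thesis ..
qed

section \<open>Tangent spaces of the rank strata\<close>

lemma has_vector_derivative_matrix_inv:
  fixes f :: "real \<Rightarrow> real^'n^'n"
  assumes "(f has_vector_derivative f') (at x)" "invertible (f x)"
  shows "((\<lambda>t. matrix_inv (f t)) has_vector_derivative
           - (matrix_inv (f x) ** f' ** matrix_inv (f x))) (at x)"
  using has_derivative_matrix_inv[OF assms(1)[unfolded has_vector_derivative_def] assms(2)]
  unfolding has_vector_derivative_def
  by (simp add: matmul.scaleR_left matmul.scaleR_right)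

lemmas has_vector_derivative_matrix_mult =
  bounded_bilinear.has_vector_derivative[OF bounded_bilinear_matrix_mult]

lemmas has_vector_derivative_transpose =
  bounded_linear.has_vector_derivative[OF bounded_linear_transpose]

text \<open>
  Tangency conditions are obtained by differentiating identities that hold along a curve for small
  times; this lemma is the form in which they are used.
\<close>

lemma has_vector_derivative_locally_zero:
  assumes f: "(f has_vector_derivative d) (at x)" and z: "eventually (\<lambda>t. f t = 0) (at x)" "f x = 0"
  shows "d = 0"
proof -
  have "((\<lambda>t. 0) has_vector_derivative d) (at x)"
    using f unfolding has_vector_derivative_def
    by (rule has_derivative_transform_eventually) (use z in auto)
  then show ?thesis
    using has_vector_derivative_const vector_derivative_unique_at by blast
qed

lemma has_vector_derivative_tendsto:
  assumes "(f has_vector_derivative d) (at x)"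
  shows "(f \<longlongrightarrow> f x) (at x)"
  using has_vector_derivative_continuous[OF assms] by (simp add: continuous_at)

lemma line_has_vector_derivative: "((\<lambda>t. a + t *\<^sub>R b) has_vector_derivative b) (at x)"
  by (auto intro!: derivative_eq_intros)

definition congruence_curve :: "real^'n^'n \<Rightarrow> real^'n^'n \<Rightarrow> real \<Rightarrow> real^'n^'n" where
  "congruence_curve C A t = (mat 1 + t *\<^sub>R C) ** A ** transpose (mat 1 + t *\<^sub>R C)"

lemma congruence_curve_0: "congruence_curve C A 0 = A"
  by (simp add: congruence_curve_def)

lemma congruence_curve_derivative:
  "(congruence_curve C A has_vector_derivative C ** A + A ** transpose C) (at 0)"
proof -
  note g = line_has_vector_derivative[of "mat 1" C 0]
  have "((\<lambda>t. (mat 1 + t *\<^sub>R C) ** A ** transpose (mat 1 + t *\<^sub>R C)) has_vector_derivative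
      (mat 1 + 0 *\<^sub>R C) ** A ** transpose C
      + ((mat 1 + 0 *\<^sub>R C) ** 0 + C ** A) ** transpose (mat 1 + 0 *\<^sub>R C)) (at 0)"
    by (intro has_vector_derivative_matrix_mult has_vector_derivative_transpose
        has_vector_derivative_const g)
  then show ?thesis
    unfolding congruence_curve_def[abs_def] by (simp add: matrix_ring_simps add.commute)
qed

lemma C_diff_congruence_curve: "C_diff k UNIV (congruence_curve C A)"
proof -
  have l: "C_diff k UNIV (\<lambda>t::real. t *\<^sub>R D)" for D :: "real^'n^'n"
    by (intro C_diff_bounded_linear bounded_linear_scaleR_left)
  have g: "C_diff k UNIV (\<lambda>t::real. mat 1 + t *\<^sub>R D)" for D :: "real^'n^'n"
    by (intro C_diff_add C_diff_const l open_UNIV)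
  have "transpose (mat 1 + t *\<^sub>R C) = mat 1 + t *\<^sub>R transpose C" for t
    by (simp add: transpose_simps transpose_scalar)
  then show ?thesis
    unfolding congruence_curve_def[abs_def]
    by (simp only:) (intro C_diff_matrix_mult C_diff_const g open_UNIV)
qed

lemma eventually_invertible_line: "eventually (\<lambda>t. invertible (mat 1 + t *\<^sub>R (C :: real^'n^'n))) (at 0)"
proof (rule eventually_invertible)
  show "((\<lambda>t. mat 1 + t *\<^sub>R C) \<longlongrightarrow> mat 1) (at 0)"
    using has_vector_derivative_tendsto[OF line_has_vector_derivative[of "mat 1" C 0]] by simp
  show "invertible (mat 1 :: real^'n^'n)"
    unfolding invertible_def by (metis matrix_mul_lid)
qed

lemma congruence_Skew: "A \<in> Skew \<Longrightarrow> g ** A ** transpose g \<in> Skew"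
  by (simp add: Skew_def transpose_simps matrix_ring_simps)

lemma congruence_curve_in_Skew_rank:
  assumes "A \<in> Skew_rank k" "invertible (mat 1 + t *\<^sub>R C)"
  shows "congruence_curve C A t \<in> Skew_rank k"
  using assms by (simp add: Skew_rank_def congruence_curve_def congruence_Skew
      rank_mult_invertible invertible_transpose_iff)

text \<open>
  Congruence preserves skewness and rank, so the velocities of congruence curves are tangent.
\<close>

lemma congruence_velocity_tangent:
  assumes A: "A \<in> Skew_rank k"
  shows "C ** A + A ** transpose C \<in> tangent_space (Skew_rank k) A"
proof -
  obtain \<epsilon> where \<epsilon>: "\<epsilon> > 0" and inv: "\<And>t. t \<noteq> 0 \<Longrightarrow> \<bar>t\<bar> < \<epsilon> \<Longrightarrow> invertible (mat 1 + t *\<^sub>R C)"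
    using eventually_invertible_line[of C] by (auto simp: eventually_at)
  have "congruence_curve C A t \<in> Skew_rank k" if "\<bar>t\<bar> < \<epsilon>" for t
    using congruence_curve_in_Skew_rank[OF A inv, of t] that A
    by (cases "t = 0") (auto simp: congruence_curve_0)
  then have "congruence_curve C A ` {-\<epsilon><..<\<epsilon>} \<subseteq> Skew_rank k"
    by (auto simp: abs_less_iff)
  moreover have "smooth_map_on {-\<epsilon><..<\<epsilon>} (congruence_curve C A)"
    by (rule smooth_map_onI[OF open_UNIV _ C_diff_congruence_curve]) simp
  ultimately show ?thesis
    unfolding tangent_space_def
    using \<epsilon> congruence_curve_0 congruence_curve_derivative by blast
qed

context kernel_projection
begin

lemma p_in_Skew_rank: "p \<in> Skew_rank (rank p)"
  by (simp add: Skew_rank_def skew)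

text \<open>
  Along a curve in the stratum the kernel block equals the correction term of the Schur
  complement. The latter is a product of two factors vanishing at \<open>p\<close>, hence has derivative zero.
\<close>

lemma tangent_space_subset_model: "tangent_space (Skew_rank (rank p)) p \<subseteq> tangent_model"
proof
  fix v assume "v \<in> tangent_space (Skew_rank (rank p)) p"
  then obtain \<gamma> \<epsilon> where \<epsilon>: "0 < \<epsilon>" and \<gamma>X: "\<gamma> ` {-\<epsilon><..<\<epsilon>} \<subseteq> Skew_rank (rank p)"
    and \<gamma>0: "\<gamma> 0 = p" and \<gamma>: "(\<gamma> has_vector_derivative v) (at 0)"
    unfolding tangent_space_def by blast
  have evX: "eventually (\<lambda>t. \<gamma> t \<in> Skew_rank (rank p)) (at 0)"
    unfolding eventually_at using \<epsilon> \<gamma>X by (intro exI[of _ \<epsilon>]) (auto simp: abs_less_iff)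
  have "transpose v + v = 0"
  proof (rule has_vector_derivative_locally_zero)
    show "((\<lambda>t. transpose (\<gamma> t) + \<gamma> t) has_vector_derivative transpose v + v) (at 0)"
      by (intro has_vector_derivative_add has_vector_derivative_transpose \<gamma>)
    show "eventually (\<lambda>t. transpose (\<gamma> t) + \<gamma> t = 0) (at 0)"
      using evX by eventually_elim (simp add: Skew_rank_def Skew_def)
    show "transpose (\<gamma> 0) + \<gamma> 0 = 0" using \<gamma>0 SkewD[OF skew] by simp
  qed
  then have vS: "v \<in> Skew" by (simp add: Skew_def eq_neg_iff_add_eq_0)
  have core: "((\<lambda>t. core (\<gamma> t)) has_vector_derivative P ** v ** P) (at 0)"
  proof -
    have "((\<lambda>t. P ** \<gamma> t ** P + Q) has_vector_derivative
        (P ** \<gamma> 0) ** 0 + (P ** v + 0 ** \<gamma> 0) ** P + 0) (at 0)"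
      by (intro has_vector_derivative_add has_vector_derivative_matrix_mult
          has_vector_derivative_const \<gamma>)
    then show ?thesis by (simp add: core_def matrix_ring_simps)
  qed
  have inv0: "invertible (core (\<gamma> 0))" using invertible_core_p \<gamma>0 by simp
  have "((\<lambda>t. matrix_inv (core (\<gamma> t)) - Q) has_vector_derivative
      - (matrix_inv (core (\<gamma> 0)) ** (P ** v ** P) ** matrix_inv (core (\<gamma> 0))) - 0) (at 0)"
    by (intro has_vector_derivative_diff has_vector_derivative_matrix_inv core inv0
        has_vector_derivative_const)
  then obtain D where D: "((\<lambda>t. block_inv (\<gamma> t)) has_vector_derivative D) (at 0)"
    unfolding block_inv_def by blast
  have "Q ** v ** Q = 0"
  proof (rule has_vector_derivative_locally_zero)
    have "((\<lambda>t. Q ** \<gamma> t ** Q - Q ** \<gamma> t ** block_inv (\<gamma> t) ** (\<gamma> t ** Q)) has_vector_derivative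
       ((Q ** \<gamma> 0) ** 0 + (Q ** v + 0 ** \<gamma> 0) ** Q)
       - ((Q ** \<gamma> 0 ** block_inv (\<gamma> 0)) ** (\<gamma> 0 ** 0 + v ** Q)
         + ((Q ** \<gamma> 0) ** D + (Q ** v + 0 ** \<gamma> 0) ** block_inv (\<gamma> 0)) ** (\<gamma> 0 ** Q))) (at 0)"
      by (intro has_vector_derivative_diff has_vector_derivative_matrix_mult
          has_vector_derivative_const \<gamma> D)
    then show "((\<lambda>t. Q ** \<gamma> t ** Q - schur_correction (\<gamma> t)) has_vector_derivative Q ** v ** Q) (at 0)"
      unfolding schur_correction_def \<gamma>0
      by (simp add: Qp pQ matmul.zero_left matmul.zero_right matrix_mul_assoc)
    have "eventually (\<lambda>t. invertible (core (\<gamma> t))) (at 0)"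
      by (rule eventually_invertible[OF has_vector_derivative_tendsto[OF core] inv0])
    then show "eventually (\<lambda>t. Q ** \<gamma> t ** Q - schur_correction (\<gamma> t) = 0) (at 0)"
      using evX by eventually_elim (use rank_eq_iff_schur in \<open>auto simp: Skew_rank_def\<close>)
    show "Q ** \<gamma> 0 ** Q - schur_correction (\<gamma> 0) = 0"
      by (simp add: \<gamma>0 schur_correction_def proj_simps matrix_ring_simps)
  qed
  with vS show "v \<in> tangent_model" by (simp add: tangent_model_def)
qed

text \<open>
  To solve \<open>C p + p C\<^sup>T = B\<close>, choose \<open>C p = P B P / 2 + Q B P\<close>, which is possible because the right
  side factors through \<open>R p = P\<close>. The two halves of \<open>P B P\<close> come from the two summands, and the
  transposed term supplies \<open>P B Q\<close>.
\<close>

lemma tangent_model_velocity: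
  assumes B: "B \<in> tangent_model"
  obtains C where "B = C ** p + p ** transpose C"
proof
  let ?C = "((1 / 2) *\<^sub>R (P ** B ** P) + Q ** B ** P) ** R"
  have BS: "transpose B = - B" and QBQ: "Q ** B ** Q = 0"
    using B by (auto simp: tangent_model_def Skew_def)
  have Cp: "?C ** p = (1 / 2) *\<^sub>R (P ** B ** P) + Q ** B ** P"
    by (simp add: matrix_mul_assoc[symmetric] Rp)
      (simp add: matrix_ring_simps matmul.scaleR_left proj_simps)
  have "p ** transpose ?C = - transpose (?C ** p)"
    by (simp add: transpose_simps SkewD[OF skew] matrix_ring_simps)
  also have "\<dots> = (1 / 2) *\<^sub>R (P ** B ** P) + P ** B ** Q"
    unfolding Cp
    by (simp add: transpose_simps transpose_scalar P_sym Q_sym BS matrix_ring_simps)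
  finally have "?C ** p + p ** transpose ?C
      = (1 / 2) *\<^sub>R (P ** B ** P) + (1 / 2) *\<^sub>R (P ** B ** P) + Q ** B ** P + P ** B ** Q"
    unfolding Cp by (simp add: algebra_simps)
  also have "\<dots> = P ** B ** P + Q ** B ** P + P ** B ** Q + Q ** B ** Q"
    by (simp add: QBQ scaleR_left_distrib[symmetric])
  also have "\<dots> = B"
    by (simp add: P_def matrix_ring_simps)
  finally show "B = ?C ** p + p ** transpose ?C" by simp
qed

lemma tangent_space_eq_model: "tangent_space (Skew_rank (rank p)) p = tangent_model"
proof (rule antisym[OF tangent_space_subset_model subsetI])
  fix B assume "B \<in> tangent_model"
  then obtain C where "B = C ** p + p ** transpose C" by (rule tangent_model_velocity)
  then show "B \<in> tangent_space (Skew_rank (rank p)) p"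
    using congruence_velocity_tangent[OF p_in_Skew_rank] by simp
qed

end

text \<open>
  The tangent space is the tangent space of the congruence orbit. Unlike the description by
  blocks, this form is manifestly compatible with congruence.
\<close>

lemma tangent_space_Skew_rank:
  assumes A: "A \<in> Skew_rank k"
  shows "tangent_space (Skew_rank k) A = {C ** A + A ** transpose C |C. True}"
proof
  obtain Q where "kernel_projection A Q"
    using kernel_projection_exists[of A] A by (auto simp: Skew_rank_def)
  then interpret kernel_projection A Q .
  have k: "rank A = k" using A by (simp add: Skew_rank_def)
  show "tangent_space (Skew_rank k) A \<subseteq> {C ** A + A ** transpose C |C. True}"
    unfolding tangent_space_eq_model[unfolded k] using tangent_model_velocity by blast
qed (use congruence_velocity_tangent[OF A] in blast)

lemma tangent_space_congruence:
  fixes A g :: "real^'n^'n"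
  assumes A: "A \<in> Skew_rank k" and g: "invertible g"
    and B: "B \<in> tangent_space (Skew_rank k) (g ** A ** transpose g)"
  shows "matrix_inv g ** B ** transpose (matrix_inv g) \<in> tangent_space (Skew_rank k) A"
proof -
  let ?h = "matrix_inv g"
  have "g ** A ** transpose g \<in> Skew_rank k"
    using A by (simp add: Skew_rank_def congruence_Skew rank_mult_invertible g invertible_transpose_iff)
  then obtain C where C: "B = C ** (g ** A ** transpose g) + (g ** A ** transpose g) ** transpose C"
    using B tangent_space_Skew_rank by blast
  note h = matrix_inv_works[OF g]
  have ht: "transpose g ** transpose ?h = mat 1"
    using h by (simp add: matrix_transpose_mul[symmetric])
  have "?h ** B ** transpose ?h = (?h ** C ** g) ** A ** (transpose g ** transpose ?h)
      + (?h ** g) ** A ** transpose (?h ** C ** g)"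
    unfolding C by (simp add: transpose_simps matrix_ring_simps)
  also have "\<dots> = (?h ** C ** g) ** A + A ** transpose (?h ** C ** g)"
    by (simp only: h ht matrix_mul_lid matrix_mul_rid)
  finally show ?thesis
    using tangent_space_Skew_rank[OF A] by blast
qed

section \<open>The second fundamental form and its trace\<close>

context kernel_projection
begin

lemma normal_component_Skew_rank:
  assumes w: "w \<in> Skew"
  shows "normal_component Skew (Skew_rank (rank p)) p w = Q ** w ** Q"
  unfolding normal_component_def normal_space_def tangent_space_eq_model
proof (rule the_equality)
  have "(Q ** w ** Q) \<bullet> \<tau> = 0" if "\<tau> \<in> tangent_model" for \<tau>
    using that by (simp add: inner_symmetric_conjugate[OF Q_sym] tangent_model_def)
  moreover have "w - Q ** w ** Q \<in> tangent_model"
    using subspace_diff[OF subspace_Skew w conjugate_Q_Skew[OF w]]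
    by (simp add: tangent_model_def matrix_ring_simps proj_simps)
  ultimately show "Q ** w ** Q \<in> {\<nu> \<in> Skew. \<forall>\<tau>\<in>tangent_model. \<nu> \<bullet> \<tau> = 0} \<and>
      w - Q ** w ** Q \<in> tangent_model"
    using conjugate_Q_Skew[OF w] by blast
  fix \<nu> assume \<nu>: "\<nu> \<in> {\<nu> \<in> Skew. \<forall>\<tau>\<in>tangent_model. \<nu> \<bullet> \<tau> = 0} \<and> w - \<nu> \<in> tangent_model"
  let ?d = "\<nu> - Q ** w ** Q"
  have "?d = (w - Q ** w ** Q) - (w - \<nu>)" by simp
  then have "?d \<in> tangent_model"
    using subspace_diff[OF subspace_tangent_model \<open>w - Q ** w ** Q \<in> tangent_model\<close>, of "w - \<nu>"] \<nu>
    by metis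
  then have "?d \<bullet> ?d = 0"
    using \<nu> \<open>\<And>\<tau>. \<tau> \<in> tangent_model \<Longrightarrow> (Q ** w ** Q) \<bullet> \<tau> = 0\<close>[of ?d]
    by (simp add: inner_diff_left)
  then show "\<nu> = Q ** w ** Q" by simp
qed

lemma tangent_model_normal_block:
  assumes "B \<in> tangent_model"
  shows "Q ** B ** P = Q ** B" "P ** B ** Q = B ** Q"
  using assms unfolding tangent_model_def P_def by (simp_all add: matrix_ring_simps)

text \<open>
  The matrix \<open>D\<close> is not determined by the velocity \<open>\<xi>\<close>, but its action into the normal directions
  is: \<open>Q D P = Q \<xi> R\<close>.
\<close>

lemma velocity_normal_block:
  assumes \<xi>: "\<xi> = D ** p + p ** transpose D" and \<eta>: "\<eta> \<in> tangent_model"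
  shows "Q ** (D ** \<eta> + \<eta> ** transpose D) ** Q = Q ** (\<xi> ** R ** \<eta> + \<eta> ** R ** \<xi>) ** Q"
proof -
  have 1: "Q ** \<xi> ** R = Q ** D ** P"
    unfolding \<xi> by (simp add: matrix_ring_simps Qp) (simp add: matrix_mul_assoc[symmetric] pR)
  have 2: "R ** \<xi> ** Q = P ** transpose D ** Q"
    unfolding \<xi> by (simp add: matrix_ring_simps Rp) (simp add: matrix_mul_assoc[symmetric] pQ matmul.zero_right)
  have "Q ** (D ** \<eta> + \<eta> ** transpose D) ** Q = Q ** D ** (\<eta> ** Q) + (Q ** \<eta>) ** transpose D ** Q"
    by (simp add: matrix_ring_simps)
  also have "\<dots> = Q ** D ** (P ** \<eta> ** Q) + (Q ** \<eta> ** P) ** transpose D ** Q"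
    by (simp only: tangent_model_normal_block[OF \<eta>])
  also have "\<dots> = (Q ** D ** P) ** \<eta> ** Q + Q ** \<eta> ** (P ** transpose D ** Q)"
    by (simp only: matrix_mul_assoc)
  also have "\<dots> = Q ** (\<xi> ** R ** \<eta> + \<eta> ** R ** \<xi>) ** Q"
    unfolding 1[symmetric] 2[symmetric] by (simp add: matrix_ring_simps)
  finally show ?thesis .
qed

text \<open>
  Let \<open>Y\<close> be tangent along the stratum and let \<open>\<gamma> = g p g\<^sup>T\<close>, \<open>g = 1 + t D\<close>, be a curve with velocity
  \<open>\<xi>\<close>. Transporting \<open>Y (\<gamma> t)\<close> back by \<open>g\<inverse>\<close> gives a tangent vector at \<open>p\<close>, whose kernel block
  vanishes. Differentiating this identity at \<open>t = 0\<close> determines the normal part of the derivative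
  of \<open>Y\<close>.
\<close>

lemma flat_connection_normal_block:
  assumes Y: "tangential_extension Skew (Skew_rank (rank p)) p \<eta> U Y"
    and \<xi>: "\<xi> \<in> tangent_model" and \<eta>: "\<eta> \<in> tangent_model"
  shows "flat_connection p \<xi> Y \<in> Skew"
    "Q ** flat_connection p \<xi> Y ** Q = Q ** (\<xi> ** R ** \<eta> + \<eta> ** R ** \<xi>) ** Q"
proof -
  let ?X = "Skew_rank (rank p) :: (real^'n^'n) set"
  have pU: "p \<in> U" and YS: "Y ` U \<subseteq> Skew" and Yp: "Y p = \<eta>"
    and YT: "\<And>q. q \<in> ?X \<inter> U \<Longrightarrow> Y q \<in> tangent_space ?X q" and Ysm: "smooth_map_on U Y"
    using Y unfolding tangential_extension_def by auto
  obtain T where T: "open T" "U = Skew \<inter> T"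
    using Y unfolding tangential_extension_def openin_open by auto
  obtain N F where N: "open N" "p \<in> N" and F: "\<And>k. C_diff k N F" and FY: "\<And>y. y \<in> U \<inter> N \<Longrightarrow> F y = Y y"
  proof -
    have "\<exists>N F. open N \<and> p \<in> N \<and> (\<forall>k. C_diff k N F) \<and> (\<forall>y\<in>U \<inter> N. F y = Y y)"
      using Ysm pU unfolding smooth_map_on_def by (rule bspec)
    then show ?thesis
      by (elim exE conjE) (rule that, assumption, assumption, erule spec, erule bspec, assumption)
  qed
  define F' where "F' = frechet_derivative F (at p)"
  have dF: "(F has_derivative F') (at p)"
    unfolding F'_def by (rule C_diff_has_derivative[OF F N(2)])
  have Fp: "F p = \<eta>" using FY[of p] pU N(2) Yp by simp
  have along: "((\<lambda>t. F (c t)) has_vector_derivative F' v) (at 0)"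
    if "(c has_vector_derivative v) (at 0)" "c 0 = p" for c v
  proof -
    have "((\<lambda>t. F (c t)) has_derivative (\<lambda>h. F' (h *\<^sub>R v))) (at 0)"
      using has_derivative_compose[OF that(1)[unfolded has_vector_derivative_def], of F F'] dF that(2)
      by simp
    then show ?thesis
      unfolding has_vector_derivative_def
      by (simp add: linear_simps(5)[OF has_derivative_bounded_linear[OF dF]])
  qed
  have near: "eventually (\<lambda>t. c t \<in> T \<inter> N) (at 0)"
    if "(c has_vector_derivative v) (at 0)" "c 0 = p" for c v
    using has_vector_derivative_tendsto[OF that(1)] that(2) N T pU
    by (intro topological_tendstoD) auto
  have \<xi>S: "\<xi> \<in> Skew" using \<xi> by (simp add: tangent_model_def)
  have line: "((\<lambda>t. p + t *\<^sub>R \<xi>) has_vector_derivative \<xi>) (at 0)"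
    by (rule line_has_vector_derivative)
  have lineS: "p + t *\<^sub>R \<xi> \<in> Skew" for t
    by (intro subspace_add subspace_scale subspace_Skew skew \<xi>S)
  have lineU: "eventually (\<lambda>t. p + t *\<^sub>R \<xi> \<in> U \<inter> N) (at 0)"
    using near[OF line] by (auto elim: eventually_mono simp: T(2) lineS)
  have dFline: "((\<lambda>t. F (p + t *\<^sub>R \<xi>)) has_vector_derivative F' \<xi>) (at 0)"
    using along[OF line] by simp
  have "((\<lambda>t. Y (p + t *\<^sub>R \<xi>)) has_vector_derivative F' \<xi>) (at 0)"
    using dFline unfolding has_vector_derivative_def
  proof (rule has_derivative_transform_eventually)
    show "eventually (\<lambda>t. F (p + t *\<^sub>R \<xi>) = Y (p + t *\<^sub>R \<xi>)) (at 0)"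
      using lineU by eventually_elim (rule FY)
  qed (use Fp Yp in auto)
  then have flat: "flat_connection p \<xi> Y = F' \<xi>"
    unfolding flat_connection_def by (rule vector_derivative_at)
  have "transpose (F' \<xi>) + F' \<xi> = 0"
  proof (rule has_vector_derivative_locally_zero)
    show "((\<lambda>t. transpose (F (p + t *\<^sub>R \<xi>)) + F (p + t *\<^sub>R \<xi>)) has_vector_derivative
        transpose (F' \<xi>) + F' \<xi>) (at 0)"
      by (intro has_vector_derivative_add has_vector_derivative_transpose dFline)
    have "transpose (F q) + F q = 0" if "q \<in> U \<inter> N" for q
      using FY[OF that] YS that SkewD[of "Y q"] by auto
    then show "eventually (\<lambda>t. transpose (F (p + t *\<^sub>R \<xi>)) + F (p + t *\<^sub>R \<xi>) = 0) (at 0)"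
      "transpose (F (p + 0 *\<^sub>R \<xi>)) + F (p + 0 *\<^sub>R \<xi>) = 0"
      using lineU pU N(2) by (auto elim: eventually_mono)
  qed
  then show "flat_connection p \<xi> Y \<in> Skew"
    unfolding flat by (simp add: Skew_def eq_neg_iff_add_eq_0)
  obtain D where D: "\<xi> = D ** p + p ** transpose D"
    using \<xi> by (rule tangent_model_velocity)
  define \<gamma> where "\<gamma> = congruence_curve D p"
  define h where "h t = matrix_inv (mat 1 + t *\<^sub>R D)" for t
  have mat1: "matrix_inv (mat 1 :: real^'n^'n) = mat 1"
    by (rule matrix_inv_unique) simp
  have \<gamma>: "(\<gamma> has_vector_derivative \<xi>) (at 0)" "\<gamma> 0 = p"
    unfolding \<gamma>_def D by (rule congruence_curve_derivative) (rule congruence_curve_0)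
  have inv1: "invertible (mat 1 + 0 *\<^sub>R D)"
    by (simp add: invertible_iff_kernel)
  have "(h has_vector_derivative - (matrix_inv (mat 1 + 0 *\<^sub>R D) ** D ** matrix_inv (mat 1 + 0 *\<^sub>R D))) (at 0)"
    unfolding h_def by (intro has_vector_derivative_matrix_inv line_has_vector_derivative inv1)
  then have h: "(h has_vector_derivative - D) (at 0)" "h 0 = mat 1"
    by (simp_all add: mat1 h_def)
  have "Q ** (F' \<xi> - (D ** \<eta> + \<eta> ** transpose D)) ** Q = 0"
  proof (rule has_vector_derivative_locally_zero)
    have "((\<lambda>t. Q ** (h t ** F (\<gamma> t) ** transpose (h t)) ** Q) has_vector_derivative
       (Q ** (h 0 ** F (\<gamma> 0) ** transpose (h 0))) ** 0
       + (Q ** ((h 0 ** F (\<gamma> 0)) ** transpose (- D)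
              + (h 0 ** F' \<xi> + (- D) ** F (\<gamma> 0)) ** transpose (h 0))
          + 0 ** (h 0 ** F (\<gamma> 0) ** transpose (h 0))) ** Q) (at 0)"
      by (intro has_vector_derivative_matrix_mult has_vector_derivative_const
          has_vector_derivative_transpose h(1) along[OF \<gamma>])
    then show "((\<lambda>t. Q ** (h t ** F (\<gamma> t) ** transpose (h t)) ** Q) has_vector_derivative
       Q ** (F' \<xi> - (D ** \<eta> + \<eta> ** transpose D)) ** Q) (at 0)"
      by (simp add: h(2) \<gamma>(2) Fp matrix_ring_simps transpose_simps algebra_simps)
    show "eventually (\<lambda>t. Q ** (h t ** F (\<gamma> t) ** transpose (h t)) ** Q = 0) (at 0)"
      using near[OF \<gamma>] eventually_invertible_line[of D]
    proof eventually_elim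
      case (elim t)
      have \<gamma>X: "\<gamma> t \<in> ?X"
        unfolding \<gamma>_def by (rule congruence_curve_in_Skew_rank[OF p_in_Skew_rank elim(2)])
      then have \<gamma>U: "\<gamma> t \<in> U" using elim(1) T(2) by (simp add: Skew_rank_def)
      then have "F (\<gamma> t) \<in> tangent_space ?X (\<gamma> t)"
        using YT[of "\<gamma> t"] FY[of "\<gamma> t"] \<gamma>X elim(1) by simp
      then have "h t ** F (\<gamma> t) ** transpose (h t) \<in> tangent_space ?X p"
        unfolding h_def \<gamma>_def congruence_curve_def
        by (rule tangent_space_congruence[OF p_in_Skew_rank elim(2)])
      then show ?case
        unfolding tangent_space_eq_model tangent_model_def by simp
    qed
    show "Q ** (h 0 ** F (\<gamma> 0) ** transpose (h 0)) ** Q = 0"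
      using \<eta> by (simp add: h(2) \<gamma>(2) Fp tangent_model_def)
  qed
  then have "Q ** F' \<xi> ** Q = Q ** (D ** \<eta> + \<eta> ** transpose D) ** Q"
    by (simp add: matmul.diff_left matmul.diff_right)
  then show "Q ** flat_connection p \<xi> Y ** Q = Q ** (\<xi> ** R ** \<eta> + \<eta> ** R ** \<xi>) ** Q"
    unfolding flat using velocity_normal_block[OF D \<eta>] by simp
qed

text \<open>Infinitesimal congruences are linear vector fields tangent to all rank strata.\<close>

lemma congruence_field_extension:
  assumes \<eta>: "\<eta> = C ** p + p ** transpose C"
  shows "tangential_extension Skew (Skew_rank (rank p)) p \<eta> Skew (\<lambda>A. C ** A + A ** transpose C)"
  unfolding tangential_extension_def
proof (intro conjI ballI)
  have "bounded_linear (\<lambda>A :: real^'n^'n. C ** A + A ** transpose C)"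
    by (intro bounded_linear_add matmul.bounded_linear_left matmul.bounded_linear_right)
  then show "smooth_map_on Skew (\<lambda>A. C ** A + A ** transpose C)"
    by (intro smooth_map_onI[OF open_UNIV] C_diff_bounded_linear) auto
  show "(\<lambda>A. C ** A + A ** transpose C) ` Skew \<subseteq> Skew"
    by (auto simp: Skew_def transpose_simps matrix_ring_simps)
  show "C ** q + q ** transpose C \<in> tangent_space (Skew_rank (rank p)) q"
    if "q \<in> Skew_rank (rank p) \<inter> Skew" for q
    using that congruence_velocity_tangent by blast
qed (auto simp: skew \<eta>)

lemma second_fundamental_form_Skew_rank:
  assumes \<xi>: "\<xi> \<in> tangent_model" and \<eta>: "\<eta> \<in> tangent_model"
  shows "second_fundamental_form Skew (Skew_rank (rank p)) p \<xi> \<eta>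
    = Q ** (\<xi> ** R ** \<eta> + \<eta> ** R ** \<xi>) ** Q"
proof -
  have val: "normal_component Skew (Skew_rank (rank p)) p (flat_connection p \<xi> Y)
      = Q ** (\<xi> ** R ** \<eta> + \<eta> ** R ** \<xi>) ** Q"
    if "tangential_extension Skew (Skew_rank (rank p)) p \<eta> U Y" for U Y
    using flat_connection_normal_block[OF that \<xi> \<eta>] by (simp add: normal_component_Skew_rank)
  obtain C where "\<eta> = C ** p + p ** transpose C"
    using \<eta> by (rule tangent_model_velocity)
  note ext = congruence_field_extension[OF this]
  show ?thesis
    unfolding second_fundamental_form_def
  proof (rule the_equality)
    show "\<exists>U Y. tangential_extension Skew (Skew_rank (rank p)) p \<eta> U Y \<and>
        Q ** (\<xi> ** R ** \<eta> + \<eta> ** R ** \<xi>) ** Q =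
        normal_component Skew (Skew_rank (rank p)) p (flat_connection p \<xi> Y)"
      by (intro exI conjI, rule ext, rule val[OF ext, symmetric])
    show "b = Q ** (\<xi> ** R ** \<eta> + \<eta> ** R ** \<xi>) ** Q"
      if "\<exists>U Y. tangential_extension Skew (Skew_rank (rank p)) p \<eta> U Y \<and>
        b = normal_component Skew (Skew_rank (rank p)) p (flat_connection p \<xi> Y)" for b
      using that by (elim exE conjE) (simp only: val)
  qed
qed

lemma trace_R: "trace R = 0"
proof -
  have "R $ i $ i = 0" for i
    using arg_cong[OF R_skew, of "\<lambda>M. M $ i $ i"] by (simp add: transpose_def)
  then show ?thesis by (simp add: trace_def)
qed

text \<open>
  For matrix units, \<open>E\<^sub>i\<^sub>j R E\<^sub>i\<^sub>j = R\<^sub>j\<^sub>i E\<^sub>i\<^sub>j\<close> sums to \<open>R\<^sup>T = - R\<close>, and \<open>E\<^sub>j\<^sub>i R E\<^sub>i\<^sub>j = R\<^sub>i\<^sub>i E\<^sub>j\<^sub>j\<close> sums to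
  \<open>trace R\<close> times the identity, which is zero.
\<close>

lemma sum_matrix_units_R:
  "(\<Sum>b\<in>Basis. skew_part b ** R ** b) = - (1 / 2) *\<^sub>R R"
proof -
  have "(skew_part (axis i (axis j 1)) ** R ** axis i (axis j 1)) $ k $ l =
      ((if k = i \<and> l = j then R $ j $ i else 0) - (if k = j \<and> l = j then R $ i $ i else 0)) / 2"
    for i j k l
  proof -
    let ?E = "axis i (axis j 1) :: real^'n^'n" and ?E' = "axis j (axis i 1) :: real^'n^'n"
    have one: "(mat 1 :: real^'n^'n) $ a $ b = (if a = b then 1 else 0)" for a b
      by (simp add: mat_def)
    have unit: "(X ** axis a (axis b 1)) $ k $ l = (if l = b then X $ k $ a else 0)" for X :: "real^'n^'n" and a b
      using matrix_unit_mult[of X a b "mat 1" k l] by (auto simp: one)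
    have unit': "((axis a (axis b 1) :: real^'n^'n) ** X) $ k $ l = (if k = a then X $ b $ l else 0)" for X :: "real^'n^'n" and a b k l
      using matrix_unit_mult[of "mat 1" a b X k l] by (auto simp: one)
    have "skew_part ?E ** R ** ?E = (1 / 2) *\<^sub>R (?E ** R ** ?E - ?E' ** R ** ?E)"
      by (simp add: skew_part_def transpose_matrix_unit matmul.scaleR_left matmul.diff_left)
    then show ?thesis by (simp add: unit unit')
  qed
  then have "(\<Sum>b\<in>Basis. skew_part b ** R ** b) $ k $ l
      = ((\<Sum>i\<in>UNIV. \<Sum>j\<in>UNIV. if k = i \<and> l = j then R $ j $ i else 0)
        - (\<Sum>i\<in>UNIV. \<Sum>j\<in>UNIV. if k = j \<and> l = j then R $ i $ i else 0)) / 2" for k l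
    by (simp only: sum_Basis_matrix sum_component sum_divide_distrib[symmetric] sum_subtractf)
  moreover have "(\<Sum>i\<in>UNIV. \<Sum>j\<in>UNIV. if k = i \<and> l = j then R $ j $ i else 0) = R $ l $ k" for k l
  proof -
    have "(\<Sum>i\<in>UNIV. \<Sum>j\<in>UNIV. if k = i \<and> l = j then R $ j $ i else 0)
        = (\<Sum>i\<in>UNIV. if k = i then R $ l $ i else 0)"
      by (intro sum.cong) auto
    then show ?thesis by simp
  qed
  moreover have "(\<Sum>i\<in>UNIV. \<Sum>j\<in>UNIV. if k = j \<and> l = j then R $ i $ i else 0) = 0" for k l :: 'n
  proof -
    have "(\<Sum>i\<in>UNIV. \<Sum>j\<in>UNIV. if k = j \<and> l = j then R $ i $ i else 0)
        = (\<Sum>i\<in>UNIV. \<Sum>j\<in>UNIV. if k = j then if k = l then R $ i $ i else 0 else 0)"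
      by (intro sum.cong) auto
    then show ?thesis using trace_R by (cases "k = l") (simp_all add: trace_def)
  qed
  ultimately have sum: "(\<Sum>b\<in>Basis. skew_part b ** R ** b) $ k $ l = R $ l $ k / 2" for k l
    by simp
  have "(\<Sum>b\<in>Basis. skew_part b ** R ** b) $ k $ l = - (R $ k $ l / 2)" for k l
    using sum[of k l] arg_cong[OF R_skew, of "\<lambda>M. M $ k $ l"] by (simp add: transpose_def)
  then show ?thesis
    by (simp add: vec_eq_iff)
qed

text \<open>
  In the sum over the standard basis the second fundamental form contracts to a multiple of the
  kernel block of \<open>R\<close>, the inverse of \<open>p\<close> on its range, and this block is zero.
\<close>

lemma mean_curvature_Skew_rank: "mean_curvature Skew (Skew_rank (rank p)) p = 0"
proof -
  define B where "B = (SOME B. orthonormal_basis tangent_model B)"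
  have B: "orthonormal_basis tangent_model B"
    unfolding B_def by (rule someI_ex[OF orthonormal_basis_exists[OF subspace_tangent_model]])
  define f where "f x y = x ** R ** y" for x y :: "real^'n^'n"
  have f: "bounded_bilinear f"
    unfolding f_def
    using bounded_bilinear.comp[OF bounded_bilinear_matrix_mult matmul.bounded_linear_left bounded_linear_ident]
    by blast
  \<comment> \<open>The kernel block removed by the projection is annihilated by \<open>R\<close>.\<close>
  have sk: "Q ** f (tangent_projection b) b ** Q = Q ** (skew_part b ** R ** b) ** Q" for b
    unfolding f_def tangent_projection_def
    by (simp add: matrix_ring_simps R_props R_props(1)[THEN matrix_absorb2])
  have sumQ: "Q ** (\<Sum>e\<in>S. g e) ** Q = (\<Sum>e\<in>S. Q ** g e ** Q)" for S :: "(real^'n^'n) set" and g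
    by (simp add: matmul.sum_left matmul.sum_right)
  have "mean_curvature Skew (Skew_rank (rank p)) p
      = (\<Sum>e\<in>B. second_fundamental_form Skew (Skew_rank (rank p)) p e e)"
    unfolding mean_curvature_def metric_trace_def tangent_space_eq_model B_def ..
  also have "\<dots> = (\<Sum>e\<in>B. 2 *\<^sub>R (Q ** f e e ** Q))"
  proof (rule sum.cong)
    fix e assume "e \<in> B"
    then have "e \<in> tangent_model" using B by (auto simp: orthonormal_basis_def)
    then show "second_fundamental_form Skew (Skew_rank (rank p)) p e e = 2 *\<^sub>R (Q ** f e e ** Q)"
      by (simp only: second_fundamental_form_Skew_rank f_def matmul.add_left matmul.add_right scaleR_2)
  qed simp
  also have "\<dots> = 2 *\<^sub>R (Q ** (\<Sum>e\<in>B. f e e) ** Q)"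
    by (simp add: sumQ scaleR_sum_right)
  also have "(\<Sum>e\<in>B. f e e) = (\<Sum>b\<in>Basis. f (tangent_projection b) b)"
    by (rule sum_orthonormal_basis[OF B f tangent_projection_mem tangent_projection_orthogonal])
  also have "Q ** (\<Sum>b\<in>Basis. f (tangent_projection b) b) ** Q
      = Q ** (\<Sum>b\<in>Basis. skew_part b ** R ** b) ** Q"
    unfolding sumQ sk ..
  also have "\<dots> = 0"
    unfolding sum_matrix_units_R
    by (simp add: matmul.scaleR_left matmul.scaleR_right matrix_ring_simps R_props)
  finally show ?thesis by simp
qed

end

theorem minimal_submanifold_Skew_rank: "minimal_submanifold (Skew :: (real^'n^'n) set) (Skew_rank k)"
  unfolding minimal_submanifold_def
proof (intro conjI ballI)
  show "\<exists>d. embedded_submanifold (Skew :: (real^'n^'n) set) d (Skew_rank k)"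
    by (rule embedded_submanifold_Skew_rank)
  fix p :: "real^'n^'n" assume p: "p \<in> Skew_rank k"
  then obtain Q where "kernel_projection p Q"
    using kernel_projection_exists[of p] by (auto simp: Skew_rank_def)
  then show "mean_curvature Skew (Skew_rank k) p = 0"
    using kernel_projection.mean_curvature_Skew_rank p by (fastforce simp: Skew_rank_def)
qed

theorem theorem1p3:
  fixes r :: nat
  assumes "1 \<le> r" and "r \<le> CARD('n::finite) div 2"
  shows "semialgebraic (Skew_rank (2 * r) :: (real^'n^'n) set) \<and>
         minimal_submanifold (Skew :: (real^'n^'n) set) (Skew_rank (2 * r))"
  using semialgebraic_Skew_rank minimal_submanifold_Skew_rank by (rule conjI)

end
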